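(* Let $(\Phi, G)$ be a perception pair with $\mathrm{dom}(\Phi) = X$ such that $\Phi$ is totally bounded and endows $X$ with a metric structure (i.e. $D_X$ is a metric on $X$). Then $(\Phi, G)$ admits a compactification $(\Phi^*, G^* )$, $\mathrm{dom}(\Phi^* ) = X^*$.
   Context: Let $X$ be a non-empty set and let $\mathbb{R}^X_b$ be the space of bounded functions $X\to\mathbb{R}$ with the uniform norm $\|\cdot\|_\infty$. A data set on $X$ is a subset $\Phi\subseteq\mathbb{R}^X_b$ with the metric $D_\Phi(\varphi_1,\varphi_2)=\|\varphi_1-\varphi_2\|_\infty$; one writes $\mathrm{dom}(\Phi)=X$. The set $X$ is given the extended pseudo-metric $D_X(x_1,x_2)=\sup_{\varphi\in\Phi}|\varphi(x_1)-\varphi(x_2)|$. "$\Phi$ endows $X$ with a metric structure" means that $D_X$ is a metric. $\mathrm{Aut}_\Phi(X)$ is the group (under composition) of all bijections $g:X\to X$ such that $\varphi\circ g\in\Phi$ and $\varphi\circ g^{-1}\in\Phi$ for all $\varphi\in\Phi$. It carries the (extended) pseudo-metric $D_{\mathrm{Aut}}(g,h)=\sup_{\varphi\in\Phi}D_\Phi(\varphi g,\varphi h)$. A perception pair $(\Phi,G)$ consists of such a $\Phi$ and a subgroup $G$ of $\mathrm{Aut}_\Phi(X)$, with $G$ carrying the restriction of $D_{\mathrm{Aut}}$. A perception pair $(\Phi,G)$ with $\mathrm{dom}(\Phi)=X$ is compact if $\Phi$, $G$ and $X$ (with respect to $D_\Phi$, $D_{\mathrm{Aut}}$, $D_X$)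 are all compact. A perception pair $(\Phi,G)$ with $\mathrm{dom}(\Phi)=X$ is isometrically embedded into a perception pair $(\Phi^*,G^* )$ with $\mathrm{dom}(\Phi^* )=X^*$ if there are isometric (distance-preserving) embeddings $j^*:X\to X^*$, $i^*:\Phi\to\Phi^*$, $k^*:G\to G^*$ such that the images $j^*(X)$, $i^*(\Phi)$, $k^*(G)$ are dense in $X^*$, $\Phi^*$, $G^*$ respectively, and $i^*(\varphi)\circ j^*=\varphi$ for every $\varphi\in\Phi$ and $k^*(g)\circ j^*=j^*\circ g$ for every $g\in G$. If moreover $(\Phi^*,G^* )$ is compact, it is called a compactification of $(\Phi,G)$. *)

theory Defs
  imports "HOL-Analysis.Analysis" "HOL-Algebra.Bij"
begin

text \<open>
  Functions on a carrier set \<open>X\<close> are represented by extensional functions (fixed to \<open>undefined\<close>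
  outside \<open>X\<close>), so that equality of HOL functions is equality of functions on \<open>X\<close>. Composition
  \<open>f \<circ> g\<close> on \<open>X\<close> is \<open>compose X f g\<close>.
\<close>

section \<open>Extended pseudo-metrics\<close>

text \<open>
  \<open>Metric_space\<close> covers neither infinite distances nor distinct points at distance zero.
  Extended pseudo-metrics are therefore functions into \<open>ennreal\<close>; note that in \<open>ennreal\<close> the
  supremum of the empty family is \<open>0\<close>.
\<close>

definition ext_pseudo_metric :: "'a set \<Rightarrow> ('a \<Rightarrow> 'a \<Rightarrow> ennreal) \<Rightarrow> bool" where
  "ext_pseudo_metric M d \<longleftrightarrow>
     (\<forall>x\<in>M. d x x = 0) \<and> (\<forall>x\<in>M. \<forall>y\<in>M. d x y = d y x) \<and>
     (\<forall>x\<in>M. \<forall>y\<in>M. \<forall>z\<in>M. d x z \<le> d x y + d y z)"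

definition epm_topology :: "'a set \<Rightarrow> ('a \<Rightarrow> 'a \<Rightarrow> ennreal) \<Rightarrow> 'a topology" where
  "epm_topology M d =
     topology (\<lambda>U. U \<subseteq> M \<and> (\<forall>x\<in>U. \<exists>r>0. {y\<in>M. d x y < r} \<subseteq> U))"

definition is_metric :: "'a set \<Rightarrow> ('a \<Rightarrow> 'a \<Rightarrow> ennreal) \<Rightarrow> bool" where
  "is_metric M d \<longleftrightarrow>
     (\<forall>x\<in>M. \<forall>y\<in>M. d x y < \<infinity>) \<and> Metric_space M (\<lambda>x y. enn2real (d x y))"

lemma openin_epm_topology:
  "openin (epm_topology M d) U \<longleftrightarrow> U \<subseteq> M \<and> (\<forall>x\<in>U. \<exists>r>0. {y\<in>M. d x y < r} \<subseteq> U)"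
proof -
  have "istopology (\<lambda>U. U \<subseteq> M \<and> (\<forall>x\<in>U. \<exists>r>0. {y\<in>M. d x y < r} \<subseteq> U))"
    unfolding istopology_def
  proof (intro conjI allI impI)
    fix S T
    assume S: "S \<subseteq> M \<and> (\<forall>x\<in>S. \<exists>r>0. {y\<in>M. d x y < r} \<subseteq> S)"
      and T: "T \<subseteq> M \<and> (\<forall>x\<in>T. \<exists>r>0. {y\<in>M. d x y < r} \<subseteq> T)"
    show "S \<inter> T \<subseteq> M" using S by blast
    show "\<forall>x\<in>S \<inter> T. \<exists>r>0. {y\<in>M. d x y < r} \<subseteq> S \<inter> T"
    proof
      fix x assume "x \<in> S \<inter> T"
      then have "x \<in> S" "x \<in> T" by auto
      obtain r where r: "r > 0" "{y\<in>M. d x y < r} \<subseteq> S"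
        using S \<open>x \<in> S\<close> by blast
      obtain s where s: "s > 0" "{y\<in>M. d x y < s} \<subseteq> T"
        using T \<open>x \<in> T\<close> by blast
      from r s show "\<exists>r>0. {y\<in>M. d x y < r} \<subseteq> S \<inter> T"
        by (intro exI[of _ "min r s"]) auto
    qed
  next
    fix \<K>
    assume K: "\<forall>K\<in>\<K>. K \<subseteq> M \<and> (\<forall>x\<in>K. \<exists>r>0. {y\<in>M. d x y < r} \<subseteq> K)"
    then show "\<Union>\<K> \<subseteq> M" by blast
    show "\<forall>x\<in>\<Union>\<K>. \<exists>r>0. {y\<in>M. d x y < r} \<subseteq> \<Union>\<K>"
    proof
      fix x assume "x \<in> \<Union>\<K>"
      then obtain K r where "K \<in> \<K>" "r > 0" "{y\<in>M. d x y < r} \<subseteq> K"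
        using K by blast
      then show "\<exists>r>0. {y\<in>M. d x y < r} \<subseteq> \<Union>\<K>"
        by (intro exI[of _ r]) blast
    qed
  qed
  then show ?thesis
    by (simp add: epm_topology_def topology_inverse')
qed

lemma topspace_epm_topology [simp]: "topspace (epm_topology M d) = M"
proof (rule antisym)
  show "topspace (epm_topology M d) \<subseteq> M"
    using openin_epm_topology[of M d "topspace (epm_topology M d)"] by simp
  have "openin (epm_topology M d) M"
    unfolding openin_epm_topology by (auto intro: exI[of _ 1])
  then show "M \<subseteq> topspace (epm_topology M d)"
    by (rule openin_subset)
qed

lemma epm_topology_eq_mtopology:
  assumes "is_metric M d"
  shows "epm_topology M d = Metric_space.mtopology M (\<lambda>x y. enn2real (d x y))"
proof -
  have fin: "\<And>x y. x \<in> M \<Longrightarrow> y \<in> M \<Longrightarrow> d x y < \<infinity>"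
    and ms: "Metric_space M (\<lambda>x y. enn2real (d x y))"
    using assms by (auto simp: is_metric_def)
  interpret Metric_space M "\<lambda>x y. enn2real (d x y)" by (fact ms)
  have lt: "d x y < ennreal r \<longleftrightarrow> enn2real (d x y) < r" if "x \<in> M" "y \<in> M" "r > 0" for x y r
    using fin[OF that(1,2)] that(3)
    by (cases "d x y") (auto simp: ennreal_less_iff)
  have eq: "(\<exists>r>0. {y\<in>M. d x y < r} \<subseteq> U) \<longleftrightarrow> (\<exists>r>0. mball x r \<subseteq> U)" if "x \<in> M" for x U
  proof
    assume "\<exists>r>0. {y\<in>M. d x y < r} \<subseteq> U"
    then obtain r where r: "r > 0" "{y\<in>M. d x y < r} \<subseteq> U" by blast
    obtain s where s: "s > 0" "ennreal s \<le> r"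
    proof (cases r)
      case (real t)
      then show ?thesis using r(1) that by (cases "t > 0") (auto simp: ennreal_less_iff)
    next
      case top
      then show ?thesis using that[of 1] by simp
    qed
    have "mball x s \<subseteq> U"
      using r(2) s lt[OF \<open>x \<in> M\<close> _ s(1)] by (fastforce simp: subset_iff)
    then show "\<exists>r>0. mball x r \<subseteq> U" using s by blast
  next
    assume "\<exists>r>0. mball x r \<subseteq> U"
    then obtain r where r: "r > 0" "mball x r \<subseteq> U" by blast
    then have "{y\<in>M. d x y < ennreal r} \<subseteq> U"
      using lt[OF \<open>x \<in> M\<close> _ r(1)] \<open>x \<in> M\<close> by (auto simp: subset_iff)
    then show "\<exists>r>0. {y\<in>M. d x y < r} \<subseteq> U"
      using r(1) by (intro exI[of _ "ennreal r"]) auto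
  qed
  have "openin (epm_topology M d) U \<longleftrightarrow> openin mtopology U" for U
  proof (cases "U \<subseteq> M")
    case True
    then show ?thesis
      using eq by (simp add: openin_epm_topology openin_mtopology Ball_def subset_iff[of U M])
  next
    case False
    then show ?thesis by (simp add: openin_epm_topology openin_mtopology)
  qed
  then show ?thesis by (simp add: topology_eq)
qed


section \<open>Data sets\<close>

text \<open>The bounded real functions on \<open>X\<close> with the uniform metric.\<close>

abbreviation bounded_functions :: "'a set \<Rightarrow> ('a \<Rightarrow> real) metric" where
  "bounded_functions X \<equiv> funspace X euclidean_metric"

definition data_set :: "'a set \<Rightarrow> ('a \<Rightarrow> real) set \<Rightarrow> bool" where
  "data_set X \<Phi> \<longleftrightarrow> X \<noteq> {} \<and> \<Phi> \<subseteq> mspace (bounded_functions X)"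

definition data_metric :: "'a set \<Rightarrow> ('a \<Rightarrow> real) set \<Rightarrow> ('a \<Rightarrow> real) metric" where
  "data_metric X \<Phi> = submetric (bounded_functions X) \<Phi>"

definition point_dist :: "('a \<Rightarrow> real) set \<Rightarrow> 'a \<Rightarrow> 'a \<Rightarrow> ennreal" where
  "point_dist \<Phi> x y = (SUP \<phi>\<in>\<Phi>. ennreal \<bar>\<phi> x - \<phi> y\<bar>)"

lemma mspace_bounded_functions:
  "mspace (bounded_functions X) = {\<phi> \<in> extensional X. bounded (\<phi> ` X)}"
  by (auto simp: Metric_space.fspace_def Met_TC.fspace_def)

lemma mdist_data_metric:
  assumes "data_set X \<Phi>" "\<phi> \<in> \<Phi>" "\<psi> \<in> \<Phi>"
  shows "mdist (data_metric X \<Phi>) \<phi> \<psi> = (SUP x\<in>X. \<bar>\<phi> x - \<psi> x\<bar>)"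
  using assms by (auto simp: data_metric_def data_set_def Met_TC.fdist_def dist_real_def)

lemma ext_pseudo_metric_point_dist: "ext_pseudo_metric X (point_dist \<Phi>)"
  unfolding ext_pseudo_metric_def
proof (intro conjI ballI)
  show "point_dist \<Phi> x x = 0" for x
    by (simp add: point_dist_def SUP_constant bot_ennreal)
  show "point_dist \<Phi> x y = point_dist \<Phi> y x" for x y
    by (simp add: point_dist_def abs_minus_commute)
  show "point_dist \<Phi> x z \<le> point_dist \<Phi> x y + point_dist \<Phi> y z" for x y z
  proof -
    have "ennreal \<bar>\<phi> x - \<phi> z\<bar> \<le> point_dist \<Phi> x y + point_dist \<Phi> y z" if "\<phi> \<in> \<Phi>" for \<phi>
    proof -
      have "ennreal \<bar>\<phi> x - \<phi> z\<bar> \<le> ennreal \<bar>\<phi> x - \<phi> y\<bar> + ennreal \<bar>\<phi> y - \<phi> z\<bar>"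
        by (simp flip: ennreal_plus)
      also have "\<dots> \<le> point_dist \<Phi> x y + point_dist \<Phi> y z"
        unfolding point_dist_def by (intro add_mono SUP_upper that)
      finally show ?thesis .
    qed
    then show ?thesis unfolding point_dist_def[of \<Phi> x z] by (rule SUP_least)
  qed
qed


section \<open>Perception pairs\<close>

definition Aut_group :: "'a set \<Rightarrow> ('a \<Rightarrow> real) set \<Rightarrow> ('a \<Rightarrow> 'a) monoid" where
  "Aut_group X \<Phi> = BijGroup X
     \<lparr>carrier := {g \<in> Bij X. \<forall>\<phi>\<in>\<Phi>. compose X \<phi> g \<in> \<Phi> \<and>
                                    compose X \<phi> (inv\<^bsub>BijGroup X\<^esub> g) \<in> \<Phi>}\<rparr>"

definition aut_dist ::
    "'a set \<Rightarrow> ('a \<Rightarrow> real) set \<Rightarrow> ('a \<Rightarrow> 'a) \<Rightarrow> ('a \<Rightarrow> 'a) \<Rightarrow> ennreal" where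
  "aut_dist X \<Phi> g h =
     (SUP \<phi>\<in>\<Phi>. ennreal (mdist (data_metric X \<Phi>) (compose X \<phi> g) (compose X \<phi> h)))"

definition perception_pair :: "'a set \<Rightarrow> ('a \<Rightarrow> real) set \<Rightarrow> ('a \<Rightarrow> 'a) set \<Rightarrow> bool" where
  "perception_pair X \<Phi> G \<longleftrightarrow> data_set X \<Phi> \<and> subgroup G (Aut_group X \<Phi>)"

definition compact_perception_pair ::
    "'a set \<Rightarrow> ('a \<Rightarrow> real) set \<Rightarrow> ('a \<Rightarrow> 'a) set \<Rightarrow> bool" where
  "compact_perception_pair X \<Phi> G \<longleftrightarrow>
     perception_pair X \<Phi> G \<and>
     compact_space (mtopology_of (data_metric X \<Phi>)) \<and>
     compact_space (epm_topology G (aut_dist X \<Phi>)) \<and>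
     compact_space (epm_topology X (point_dist \<Phi>))"

lemma subgroup_Aut_group:
  assumes "data_set X \<Phi>"
  shows "subgroup (carrier (Aut_group X \<Phi>)) (BijGroup X)"
proof -
  let ?B = "BijGroup X" and ?A = "carrier (Aut_group X \<Phi>)"
  interpret B: group ?B by (rule group_BijGroup)
  have carB: "carrier ?B = Bij X" by (simp add: BijGroup_def)
  have multB: "g \<otimes>\<^bsub>?B\<^esub> h = compose X g h" if "g \<in> Bij X" "h \<in> Bij X" for g h
    using that by (simp add: BijGroup_def)
  have A: "?A = {g \<in> Bij X. \<forall>\<phi>\<in>\<Phi>. compose X \<phi> g \<in> \<Phi> \<and> compose X \<phi> (inv\<^bsub>?B\<^esub> g) \<in> \<Phi>}"
    by (simp add: Aut_group_def)
  have inv: "inv\<^bsub>?B\<^esub> g \<in> Bij X" if "g \<in> Bij X" for g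
    using B.inv_closed that by (simp add: carB)
  have assoc: "compose X \<phi> (compose X g h) = compose X (compose X \<phi> g) h"
    if "h \<in> Bij X" for \<phi> :: "'a \<Rightarrow> real" and g h
    using Bij_imp_funcset[OF that] by (auto simp: compose_def fun_eq_iff)
  show ?thesis
  proof (rule B.subgroupI)
    show "?A \<subseteq> carrier ?B" by (auto simp: A carB)
    show "inv\<^bsub>?B\<^esub> g \<in> ?A" if "g \<in> ?A" for g
      using that by (auto simp: A inv B.inv_inv carB)
    show "g \<otimes>\<^bsub>?B\<^esub> h \<in> ?A" if "g \<in> ?A" "h \<in> ?A" for g h
    proof -
      have gh: "g \<in> Bij X" "h \<in> Bij X" using that by (auto simp: A)
      have "inv\<^bsub>?B\<^esub> (g \<otimes>\<^bsub>?B\<^esub> h) = compose X (inv\<^bsub>?B\<^esub> h) (inv\<^bsub>?B\<^esub> g)"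
        using B.inv_mult_group[of g h] gh by (simp add: carB multB inv)
      then show ?thesis
        using that gh by (simp add: A multB compose_Bij assoc inv)
    qed
    have "compose X \<phi> (\<lambda>x\<in>X. x) = \<phi>" if "\<phi> \<in> \<Phi>" for \<phi>
      using assms that
      by (auto simp: data_set_def mspace_bounded_functions compose_def extensional_def fun_eq_iff
               simp del: mspace_funspace)
    moreover have "inv\<^bsub>?B\<^esub> (\<lambda>x\<in>X. x) = (\<lambda>x\<in>X. x)"
      using B.inv_one by (simp add: BijGroup_def)
    ultimately have "(\<lambda>x\<in>X. x) \<in> ?A" by (auto simp: A id_Bij)
    then show "?A \<noteq> {}" by blast
  qed
qed

lemma group_Aut_group:
  assumes "data_set X \<Phi>"
  shows "group (Aut_group X \<Phi>)"
  using subgroup.subgroup_is_group[OF subgroup_Aut_group[OF assms] group_BijGroup]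
  by (simp add: Aut_group_def)

lemma ext_pseudo_metric_aut_dist:
  assumes "perception_pair X \<Phi> G"
  shows "ext_pseudo_metric G (aut_dist X \<Phi>)"
proof -
  have mem: "compose X \<phi> g \<in> mspace (data_metric X \<Phi>)" if "g \<in> G" "\<phi> \<in> \<Phi>" for g \<phi>
  proof -
    have "g \<in> carrier (Aut_group X \<Phi>)"
      using assms \<open>g \<in> G\<close> subgroup.subset unfolding perception_pair_def by blast
    then have "compose X \<phi> g \<in> \<Phi>" using \<open>\<phi> \<in> \<Phi>\<close> by (simp add: Aut_group_def)
    then show ?thesis
      using assms unfolding data_metric_def perception_pair_def data_set_def mspace_submetric by blast
  qed
  show ?thesis
    unfolding ext_pseudo_metric_def
  proof (intro conjI ballI)
    show "aut_dist X \<Phi> g g = 0" if "g \<in> G" for g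
    proof -
      have "mdist (data_metric X \<Phi>) (compose X \<phi> g) (compose X \<phi> g) = 0" if "\<phi> \<in> \<Phi>" for \<phi>
        using Metric_space.mdist_zero[OF Metric_space_mspace_mdist mem[OF \<open>g \<in> G\<close> that]] .
      then show ?thesis by (simp add: aut_dist_def SUP_constant bot_ennreal cong: SUP_cong)
    qed
    show "aut_dist X \<Phi> g h = aut_dist X \<Phi> h g" for g h
      unfolding aut_dist_def by (intro SUP_cong refl arg_cong[where f = ennreal] mdist_commute)
    show "aut_dist X \<Phi> f h \<le> aut_dist X \<Phi> f g + aut_dist X \<Phi> g h"
      if "f \<in> G" "g \<in> G" "h \<in> G" for f g h
    proof -
      let ?d = "mdist (data_metric X \<Phi>)"
      have "ennreal (?d (compose X \<phi> f) (compose X \<phi> h)) \<le> aut_dist X \<Phi> f g + aut_dist X \<Phi> g h"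
        if "\<phi> \<in> \<Phi>" for \<phi>
      proof -
        have "?d (compose X \<phi> f) (compose X \<phi> h)
              \<le> ?d (compose X \<phi> f) (compose X \<phi> g) + ?d (compose X \<phi> g) (compose X \<phi> h)"
          by (intro mdist_triangle mem \<open>f \<in> G\<close> \<open>g \<in> G\<close> \<open>h \<in> G\<close> \<open>\<phi> \<in> \<Phi>\<close>)
        then have "ennreal (?d (compose X \<phi> f) (compose X \<phi> h))
              \<le> ennreal (?d (compose X \<phi> f) (compose X \<phi> g)) +
                ennreal (?d (compose X \<phi> g) (compose X \<phi> h))"
          by (simp only: ennreal_plus[OF mdist_nonneg mdist_nonneg, symmetric] ennreal_leI)
        also have "\<dots> \<le> aut_dist X \<Phi> f g + aut_dist X \<Phi> g h"
          unfolding aut_dist_def by (intro add_mono SUP_upper that)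
        finally show ?thesis .
      qed
      then show ?thesis unfolding aut_dist_def[of X \<Phi> f h] by (rule SUP_least)
    qed
  qed
qed


section \<open>Compactifications\<close>

text \<open>The qualified name avoids the clash with the \<open>closure_of\<close> syntax of \<open>HOL-Algebra\<close>.\<close>

definition dense_in :: "'a topology \<Rightarrow> 'a set \<Rightarrow> bool" where
  "dense_in T S \<longleftrightarrow> S \<subseteq> topspace T \<and> Abstract_Topology.closure_of T S = topspace T"

text \<open>The codomain of the two distance functions is \<open>real\<close> or \<open>ennreal\<close>.\<close>

definition isometric_embedding ::
    "'a set \<Rightarrow> ('a \<Rightarrow> 'a \<Rightarrow> 'd) \<Rightarrow> 'b set \<Rightarrow> ('b \<Rightarrow> 'b \<Rightarrow> 'd) \<Rightarrow> ('a \<Rightarrow> 'b) \<Rightarrow> bool" where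
  "isometric_embedding M d M' d' f \<longleftrightarrow>
     f \<in> M \<rightarrow> M' \<and> inj_on f M \<and> (\<forall>x\<in>M. \<forall>y\<in>M. d' (f x) (f y) = d x y)"

definition isometrically_embedded ::
    "'a set \<Rightarrow> ('a \<Rightarrow> real) set \<Rightarrow> ('a \<Rightarrow> 'a) set \<Rightarrow>
     'b set \<Rightarrow> ('b \<Rightarrow> real) set \<Rightarrow> ('b \<Rightarrow> 'b) set \<Rightarrow> bool" where
  "isometrically_embedded X \<Phi> G X' \<Phi>' G' \<longleftrightarrow>
     (\<exists>j i k.
        isometric_embedding X (point_dist \<Phi>) X' (point_dist \<Phi>') j \<and>
        isometric_embedding \<Phi> (mdist (data_metric X \<Phi>)) \<Phi>' (mdist (data_metric X' \<Phi>')) i \<and>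
        isometric_embedding G (aut_dist X \<Phi>) G' (aut_dist X' \<Phi>') k \<and>
        dense_in (epm_topology X' (point_dist \<Phi>')) (j ` X) \<and>
        dense_in (mtopology_of (data_metric X' \<Phi>')) (i ` \<Phi>) \<and>
        dense_in (epm_topology G' (aut_dist X' \<Phi>')) (k ` G) \<and>
        (\<forall>\<phi>\<in>\<Phi>. compose X (i \<phi>) j = \<phi>) \<and>
        (\<forall>g\<in>G. compose X (k g) j = compose X j g))"

definition compactification ::
    "'a set \<Rightarrow> ('a \<Rightarrow> real) set \<Rightarrow> ('a \<Rightarrow> 'a) set \<Rightarrow>
     'b set \<Rightarrow> ('b \<Rightarrow> real) set \<Rightarrow> ('b \<Rightarrow> 'b) set \<Rightarrow> bool" where
  "compactification X \<Phi> G X' \<Phi>' G' \<longleftrightarrow>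
     isometrically_embedded X \<Phi> G X' \<Phi>' G' \<and> compact_perception_pair X' \<Phi>' G'"

end

theory Submission
  imports Defs
begin

text \<open>
  The compactification is obtained by completing first the points, then the functions and the
  group on top of them.

  Total boundedness of \<open>\<Phi>\<close> passes to \<open>X\<close>: up to a small error the distance of two points is read
  off from the values of finitely many functions in \<open>\<Phi>\<close>, and these values lie in a bounded part
  of a finite-dimensional space (\<open>totally_bounded_point_metric\<close>). Hence the metric completion
  \<open>j : X \<rightarrow> X'\<close> is compact.

  With respect to \<open>point_dist\<close> every \<open>\<phi> \<in> \<Phi>\<close> is nonexpansive by definition, and so is every \<open>g \<in> G\<close>
  because \<open>\<phi> \<circ> g\<close> is again in \<open>\<Phi>\<close>. Nonexpansive maps into complete spaces extend uniquely from \<open>X\<close>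
  to \<open>X'\<close>, and by uniqueness the extension respects composition; so \<open>G\<close> acts on \<open>X'\<close> by isometries
  and permutes the extended functions.

  \<open>\<Phi>'\<close> and \<open>G'\<close> are the closures of the two families of extensions with respect to uniform
  convergence. Both are compact, being closures of totally bounded sets in complete function
  spaces: for \<open>\<Phi>'\<close> because extension is an isometry on \<open>\<Phi>\<close>, for \<open>G'\<close> by the Arzela-Ascoli argument
  (\<open>totally_bounded_nonexpansive_maps\<close>). A uniform limit of surjective isometries of the compact
  space \<open>X'\<close> is a surjective isometry, which makes \<open>G'\<close> a group.

  It remains to see that the metrics prescribed by the definition of a perception pair are the
  expected ones: \<open>point_dist \<Phi>'\<close> is the metric of the completion, by density of \<open>j ` X\<close>
  (\<open>point_dist_\<Phi>'\<close>), and the distance of automorphisms is the uniform distance of maps of \<open>X'\<close>,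
  since suprema over functions and over points commute (\<open>aut_dist'\<close>). Suprema are compared
  throughout by comparing the real upper bounds that they admit, which works alike for \<open>real\<close> and
  for \<open>ennreal\<close> and also covers \<open>\<Phi> = {}\<close>.
\<close>

section \<open>Topology, density and compactness from a metric\<close>

text \<open>
  The basic device for identifying suprema: \<open>SUP_le_iff\<close> turns a bound on a supremum into a
  pointwise bound, so no supremum has to be computed or interchanged with another.
\<close>

lemma ennreal_eq_by_real_bounds:
  fixes a b :: ennreal
  assumes "\<And>c. 0 \<le> c \<Longrightarrow> a \<le> ennreal c \<longleftrightarrow> b \<le> ennreal c"
  shows "a = b"
proof (rule antisym)
  show "a \<le> b" using assms by (cases b) auto
  show "b \<le> a" using assms by (cases a) auto
qed

lemma epm_topology_eq_subtopology:
  assumes "S \<subseteq> mspace m"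
    and "\<And>x y. x \<in> S \<Longrightarrow> y \<in> S \<Longrightarrow> D x y = ennreal (mdist m x y)"
  shows "epm_topology S D = subtopology (mtopology_of m) S"
proof -
  let ?D = "\<lambda>x y. ennreal (mdist m x y)"
  interpret M: Metric_space "mspace m" "mdist m" by (rule Metric_space_mspace_mdist)
  interpret Sub: Submetric "mspace m" "mdist m" S by unfold_locales (fact assms(1))
  have "epm_topology S D = epm_topology S ?D"
  proof -
    have ball: "{y\<in>S. D x y < r} = {y\<in>S. ?D x y < r}" if "x \<in> S" for x r
      using assms(2) that by auto
    have "(U \<subseteq> S \<and> (\<forall>x\<in>U. \<exists>r>0. {y\<in>S. D x y < r} \<subseteq> U)) \<longleftrightarrow>
               (U \<subseteq> S \<and> (\<forall>x\<in>U. \<exists>r>0. {y\<in>S. ?D x y < r} \<subseteq> U))" for U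
      by (intro conj_cong refl ball_cong) (simp only: ball subsetD)
    then show ?thesis unfolding epm_topology_def by simp
  qed
  also have "\<dots> = Sub.sub.mtopology"
  proof -
    have "is_metric S ?D"
      using Sub.sub.Metric_space_axioms by (simp add: is_metric_def)
    from epm_topology_eq_mtopology[OF this] show ?thesis by simp
  qed
  also have "\<dots> = subtopology (mtopology_of m) S"
    by (simp add: Sub.mtopology_submetric mtopology_of_def)
  finally show ?thesis .
qed

text \<open>
  Taking the new function set and the new group to be closures makes their density conditions
  immediate.
\<close>

lemma dense_in_closure:
  assumes "S \<subseteq> topspace T"
  shows "dense_in (subtopology T (Abstract_Topology.closure_of T S)) S"
  using closure_of_subset[OF assms] closure_of_subset_topspace[of T S] assms
  by (auto simp: dense_in_def closure_of_subtopology Int_absorb1 inf.absorb2)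

lemma compact_space_closure_of_totally_bounded:
  assumes "mcomplete_of m" "Metric_space.mtotally_bounded (mspace m) (mdist m) S"
  shows "compact_space (subtopology (mtopology_of m) (Abstract_Topology.closure_of (mtopology_of m) S))"
proof -
  interpret M: Metric_space "mspace m" "mdist m" by (rule Metric_space_mspace_mdist)
  show ?thesis
    using M.mtotally_bounded_eq_compact_closure_of[of S] assms
    by (simp add: mcomplete_of_def mtopology_of_def compactin_subspace)
qed

text \<open>
  Picking one representative for each value of the code gives a finite net. The code records
  finitely many approximate coordinates in both applications below.
\<close>

lemma totally_bounded_by_finite_codes:
  assumes S: "S \<subseteq> mspace m"
    and codes: "\<And>e. 0 < e \<Longrightarrow> \<exists>c :: 'a \<Rightarrow> 'c. finite (c ` S) \<and>
                  (\<forall>x\<in>S. \<forall>y\<in>S. c x = c y \<longrightarrow> mdist m x y < e)"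
  shows "Metric_space.mtotally_bounded (mspace m) (mdist m) S"
proof -
  interpret M: Metric_space "mspace m" "mdist m" by (rule Metric_space_mspace_mdist)
  show ?thesis
    unfolding M.mtotally_bounded_def
  proof (intro allI impI)
    fix e :: real assume "0 < e"
    then obtain c :: "'a \<Rightarrow> 'c" where fin: "finite (c ` S)"
      and c: "\<And>x y. x \<in> S \<Longrightarrow> y \<in> S \<Longrightarrow> c x = c y \<Longrightarrow> mdist m x y < e"
      using codes by meson
    obtain K where K: "K \<subseteq> S" "finite K" "c ` K = c ` S"
      using finite_subset_image[OF fin order_refl] by metis
    have "S \<subseteq> (\<Union>x\<in>K. M.mball x e)"
    proof
      fix y assume "y \<in> S"
      then have "c y \<in> c ` K" using K(3) by blast
      then obtain x where x: "x \<in> K" "c x = c y" by auto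
      then have "y \<in> M.mball x e"
        using c[of x y] K(1) S \<open>y \<in> S\<close> by auto
      with x show "y \<in> (\<Union>x\<in>K. M.mball x e)" by blast
    qed
    with K show "\<exists>K. finite K \<and> K \<subseteq> S \<and> S \<subseteq> (\<Union>x\<in>K. M.mball x e)" by blast
  qed
qed

lemma in_closure_of_iff_mdist_le:
  "x \<in> Abstract_Topology.closure_of (mtopology_of m) S \<longleftrightarrow>
     x \<in> mspace m \<and> (\<forall>e>0. \<exists>y\<in>S. y \<in> mspace m \<and> mdist m x y \<le> e)"
proof -
  interpret M: Metric_space "mspace m" "mdist m" by (rule Metric_space_mspace_mdist)
  show ?thesis
    by (auto simp: mtopology_of_def M.metric_closure_of_alt)
qed

lemma in_closure_of_funspace_iff:
  assumes "A \<noteq> {}" "S \<subseteq> mspace (funspace A n)"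
  shows "f \<in> Abstract_Topology.closure_of (mtopology_of (funspace A n)) S \<longleftrightarrow>
           f \<in> mspace (funspace A n) \<and> (\<forall>e>0. \<exists>s\<in>S. \<forall>x\<in>A. mdist n (f x) (s x) \<le> e)"
  unfolding in_closure_of_iff_mdist_le
proof (intro conj_cong refl all_cong1 imp_cong bex_cong)
  fix e :: real and s
  assume "f \<in> mspace (funspace A n)" "s \<in> S"
  then show "s \<in> mspace (funspace A n) \<and> mdist (funspace A n) f s \<le> e \<longleftrightarrow>
               (\<forall>x\<in>A. mdist n (f x) (s x) \<le> e)"
    using funspace_mdist_le[of f A n s e] assms by blast
qed


section \<open>Perception pairs in elementary terms\<close>

text \<open>
  Since \<open>G\<close> contains an inverse of each of its elements, bijectivity and invariance of \<open>\<Phi>\<close> under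
  \<open>g\<inverse>\<close> follow from the other conditions; this removes \<open>Bij\<close>, \<open>BijGroup\<close> and its inverse from the
  rest of the argument.
\<close>

lemma perception_pair_iff:
  "perception_pair X \<Phi> G \<longleftrightarrow>
     data_set X \<Phi> \<and> G \<subseteq> X \<rightarrow>\<^sub>E X \<and> (\<lambda>x\<in>X. x) \<in> G \<and>
     (\<forall>g\<in>G. \<forall>h\<in>G. compose X g h \<in> G) \<and>
     (\<forall>g\<in>G. \<exists>h\<in>G. compose X g h = (\<lambda>x\<in>X. x) \<and> compose X h g = (\<lambda>x\<in>X. x)) \<and>
     (\<forall>\<phi>\<in>\<Phi>. \<forall>g\<in>G. compose X \<phi> g \<in> \<Phi>)" (is "?L \<longleftrightarrow> ?R")
proof
  interpret B: group "BijGroup X" by (rule group_BijGroup)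
  have carB: "carrier (BijGroup X) = Bij X" by (simp add: BijGroup_def)
  have oneB: "\<one>\<^bsub>BijGroup X\<^esub> = (\<lambda>x\<in>X. x)" by (simp add: BijGroup_def)
  have multB: "g \<otimes>\<^bsub>BijGroup X\<^esub> h = compose X g h" if "g \<in> Bij X" "h \<in> Bij X" for g h
    using that by (simp add: BijGroup_def)
  have Aut: "(BijGroup X)\<lparr>carrier := carrier (Aut_group X \<Phi>)\<rparr> = Aut_group X \<Phi>"
    by (simp add: Aut_group_def)
  {
    assume L: ?L
    then have d: "data_set X \<Phi>" and G: "subgroup G (Aut_group X \<Phi>)"
      by (auto simp: perception_pair_def)
    have sub: "G \<subseteq> carrier (Aut_group X \<Phi>)" using G by (rule subgroup.subset)
    then have bij: "g \<in> Bij X" and act: "\<phi> \<in> \<Phi> \<Longrightarrow> compose X \<phi> g \<in> \<Phi>" if "g \<in> G" for g \<phi>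
      using that by (auto simp: Aut_group_def)
    have GB: "subgroup G (BijGroup X)"
      using B.incl_subgroup[OF subgroup_Aut_group[OF d], unfolded Aut, OF G] .
    show ?R
    proof (intro conjI ballI)
      show "data_set X \<Phi>" by (fact d)
      show "compose X \<phi> g \<in> \<Phi>" if "\<phi> \<in> \<Phi>" "g \<in> G" for \<phi> g
        using that by (intro act)
      show "G \<subseteq> X \<rightarrow>\<^sub>E X"
      proof
        fix g assume "g \<in> G"
        then show "g \<in> X \<rightarrow>\<^sub>E X"
          using Bij_imp_funcset[OF bij] Bij_imp_extensional[OF bij] by (simp add: PiE_def)
      qed
      show "(\<lambda>x\<in>X. x) \<in> G" using subgroup.one_closed[OF GB] oneB by simp
      show "compose X g h \<in> G" if "g \<in> G" "h \<in> G" for g h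
        using subgroup.m_closed[OF GB that] multB bij that by simp
      show "\<exists>h\<in>G. compose X g h = (\<lambda>x\<in>X. x) \<and> compose X h g = (\<lambda>x\<in>X. x)" if "g \<in> G" for g
      proof -
        have h: "inv\<^bsub>BijGroup X\<^esub> g \<in> G" using subgroup.m_inv_closed[OF GB that] .
        then show ?thesis
          using B.r_inv[of g] B.l_inv[of g] bij[OF that] bij[OF h] multB oneB carB
          by (intro bexI[OF _ h]) simp
      qed
    qed
  next
    assume R: ?R
    then have d: "data_set X \<Phi>" and sub_fun: "G \<subseteq> X \<rightarrow>\<^sub>E X"
      and one: "(\<lambda>x\<in>X. x) \<in> G"
      and mult: "\<And>g h. g \<in> G \<Longrightarrow> h \<in> G \<Longrightarrow> compose X g h \<in> G"
      and inverse: "\<And>g. g \<in> G \<Longrightarrow> \<exists>h\<in>G. compose X g h = (\<lambda>x\<in>X. x) \<and> compose X h g = (\<lambda>x\<in>X. x)"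
      and act: "\<And>\<phi> g. \<phi> \<in> \<Phi> \<Longrightarrow> g \<in> G \<Longrightarrow> compose X \<phi> g \<in> \<Phi>"
      by simp_all
    have bij: "g \<in> Bij X" if g: "g \<in> G" for g
    proof -
      obtain h where h: "h \<in> G" "compose X g h = (\<lambda>x\<in>X. x)" "compose X h g = (\<lambda>x\<in>X. x)"
        using inverse[OF g] by blast
      have "g (h x) = x" "h (g x) = x" if "x \<in> X" for x
        using h(2,3)[THEN fun_cong, of x] that by (simp_all add: compose_eq)
      moreover have "g \<in> X \<rightarrow>\<^sub>E X" "h \<in> X \<rightarrow>\<^sub>E X" using sub_fun that h(1) by blast+
      ultimately have "bij_betw g X X"
        by (intro bij_betw_byWitness[where f' = h]) auto
      then show ?thesis
        using \<open>g \<in> X \<rightarrow>\<^sub>E X\<close> by (simp add: Bij_def PiE_def)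
    qed
    have inv: "inv\<^bsub>BijGroup X\<^esub> g \<in> G" if g: "g \<in> G" for g
    proof -
      obtain h where h: "h \<in> G" "compose X h g = (\<lambda>x\<in>X. x)"
        using inverse[OF g] by blast
      then have "inv\<^bsub>BijGroup X\<^esub> g = h"
        using B.inv_equality[of h g] bij that multB oneB carB by simp
      with h show ?thesis by simp
    qed
    have sub: "G \<subseteq> carrier (Aut_group X \<Phi>)"
      using bij inv act by (simp add: Aut_group_def subset_iff)
    interpret A: group "Aut_group X \<Phi>" using d by (rule group_Aut_group)
    have "subgroup G (Aut_group X \<Phi>)"
    proof (rule A.subgroupI[OF sub])
      show "G \<noteq> {}" using one by blast
      show "inv\<^bsub>Aut_group X \<Phi>\<^esub> g \<in> G" if "g \<in> G" for g
        using B.m_inv_consistent[OF subgroup_Aut_group[OF d] subsetD[OF sub that]] inv[OF that]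
        unfolding Aut by simp
      show "g \<otimes>\<^bsub>Aut_group X \<Phi>\<^esub> h \<in> G" if "g \<in> G" "h \<in> G" for g h
      proof -
        have "g \<otimes>\<^bsub>Aut_group X \<Phi>\<^esub> h = compose X g h"
          using multB[OF bij[OF that(1)] bij[OF that(2)]] by (simp add: Aut_group_def)
        then show ?thesis using mult[OF that] by simp
      qed
    qed
    with d show ?L by (simp add: perception_pair_def)
  }
qed

lemma point_dist_le_iff:
  assumes "0 \<le> c"
  shows "point_dist \<Phi> x y \<le> ennreal c \<longleftrightarrow> (\<forall>\<phi>\<in>\<Phi>. \<bar>\<phi> x - \<phi> y\<bar> \<le> c)"
  using assms by (simp add: point_dist_def SUP_le_iff)

lemma mdist_data_metric_le_iff:
  assumes "data_set X \<Phi>" "\<phi> \<in> \<Phi>" "\<psi> \<in> \<Phi>"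
  shows "mdist (data_metric X \<Phi>) \<phi> \<psi> \<le> c \<longleftrightarrow> (\<forall>x\<in>X. \<bar>\<phi> x - \<psi> x\<bar> \<le> c)"
  using assms funspace_mdist_le[of \<phi> X euclidean_metric \<psi> c]
  unfolding data_metric_def data_set_def mdist_submetric by (auto simp: dist_real_def)

text \<open>
  Both sides bound \<open>\<bar>\<phi> (g x) - \<phi> (h x)\<bar>\<close> for all \<open>\<phi>\<close> and \<open>x\<close>: the distance of automorphisms is the
  uniform distance with respect to \<open>point_dist\<close>.
\<close>

lemma aut_dist_le_iff:
  assumes "perception_pair X \<Phi> G" "g \<in> G" "h \<in> G" "0 \<le> c"
  shows "aut_dist X \<Phi> g h \<le> ennreal c \<longleftrightarrow> (\<forall>x\<in>X. point_dist \<Phi> (g x) (h x) \<le> ennreal c)"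
proof -
  have d: "data_set X \<Phi>" and act: "\<And>\<phi> g. \<phi> \<in> \<Phi> \<Longrightarrow> g \<in> G \<Longrightarrow> compose X \<phi> g \<in> \<Phi>"
    using assms(1) by (auto simp: perception_pair_iff)
  have "aut_dist X \<Phi> g h \<le> ennreal c \<longleftrightarrow> (\<forall>\<phi>\<in>\<Phi>. \<forall>x\<in>X. \<bar>\<phi> (g x) - \<phi> (h x)\<bar> \<le> c)"
    unfolding aut_dist_def SUP_le_iff
    using mdist_data_metric_le_iff[OF d act act] assms(2-4) by (simp add: compose_eq)
  then show ?thesis
    using assms(4) by (auto simp: point_dist_le_iff)
qed


section \<open>Nonexpansive maps\<close>

definition nonexpansive :: "'a metric \<Rightarrow> 'b metric \<Rightarrow> ('a \<Rightarrow> 'b) \<Rightarrow> bool" where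
  "nonexpansive m n f \<longleftrightarrow>
     f \<in> mspace m \<rightarrow> mspace n \<and> (\<forall>x\<in>mspace m. \<forall>y\<in>mspace m. mdist n (f x) (f y) \<le> mdist m x y)"

lemma nonexpansive_in: "nonexpansive m n f \<Longrightarrow> x \<in> mspace m \<Longrightarrow> f x \<in> mspace n"
  by (auto simp: nonexpansive_def)

lemma nonexpansive_mdist:
  "nonexpansive m n f \<Longrightarrow> x \<in> mspace m \<Longrightarrow> y \<in> mspace m \<Longrightarrow> mdist n (f x) (f y) \<le> mdist m x y"
  by (auto simp: nonexpansive_def)

lemma nonexpansive_compose:
  assumes f: "nonexpansive m n f" and h: "nonexpansive n p h"
  shows "nonexpansive m p (compose (mspace m) h f)"
  unfolding nonexpansive_def[of m p]
proof (intro conjI ballI funcsetI)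
  fix x assume x: "x \<in> mspace m"
  show "compose (mspace m) h f x \<in> mspace p"
    using nonexpansive_in[OF h nonexpansive_in[OF f x]] x by (simp add: compose_eq)
  fix y assume y: "y \<in> mspace m"
  show "mdist p (compose (mspace m) h f x) (compose (mspace m) h f y) \<le> mdist m x y"
    using nonexpansive_mdist[OF h nonexpansive_in[OF f x] nonexpansive_in[OF f y]]
      nonexpansive_mdist[OF f x y] x y by (simp add: compose_eq)
qed

lemma nonexpansive_imp_Cauchy_continuous_map:
  assumes "nonexpansive m n f"
  shows "Cauchy_continuous_map m n f"
proof -
  have "Lipschitz_continuous_map m n f"
    using assms unfolding nonexpansive_def Lipschitz_continuous_map_def
    by (intro conjI exI[of _ 1]) auto
  then show ?thesis by (rule Lipschitz_imp_Cauchy_continuous_map)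
qed

lemma nonexpansive_uniform_limit:
  assumes "f \<in> mspace m \<rightarrow> mspace n"
    and approx: "\<And>e. 0 < e \<Longrightarrow> \<exists>s. nonexpansive m n s \<and> (\<forall>x\<in>mspace m. mdist n (f x) (s x) \<le> e)"
  shows "nonexpansive m n f"
  unfolding nonexpansive_def
proof (intro conjI ballI assms(1))
  interpret N: Metric_space "mspace n" "mdist n" by (rule Metric_space_mspace_mdist)
  fix x y assume xy: "x \<in> mspace m" "y \<in> mspace m"
  show "mdist n (f x) (f y) \<le> mdist m x y"
  proof (rule field_le_epsilon)
    fix e :: real assume "0 < e"
    then obtain s where s: "nonexpansive m n s" "\<And>x. x \<in> mspace m \<Longrightarrow> mdist n (f x) (s x) \<le> e / 2"
      using approx[of "e / 2"] by auto
    have f: "f x \<in> mspace n" "f y \<in> mspace n" using assms(1) xy by auto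
    have sxy: "s x \<in> mspace n" "s y \<in> mspace n" using nonexpansive_in[OF s(1)] xy by auto
    have "mdist n (f x) (f y) \<le> mdist n (f x) (s x) + (mdist n (s x) (s y) + mdist n (s y) (f y))"
      using N.triangle[OF f(1) sxy(1) f(2)] N.triangle[OF sxy f(2)] by linarith
    then show "mdist n (f x) (f y) \<le> mdist m x y + e"
      using s(2)[OF xy(1)] s(2)[OF xy(2)] nonexpansive_mdist[OF s(1) xy] mdist_commute[of n "s y" "f y"]
      by linarith
  qed
qed

text \<open>
  The Arzela-Ascoli argument. A nonexpansive map is determined up to a small error by its values
  on a finite net of the domain, and these matter only up to rounding to a finite net of the
  codomain; this leaves finitely many possibilities.
\<close>

lemma totally_bounded_nonexpansive_maps:
  assumes m: "Metric_space.mtotally_bounded (mspace m) (mdist m) (mspace m)"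
    and n: "Metric_space.mtotally_bounded (mspace n) (mdist n) (mspace n)"
    and S: "S \<subseteq> mspace (funspace (mspace m) n)" "\<And>f. f \<in> S \<Longrightarrow> nonexpansive m n f"
    and ne: "mspace m \<noteq> {}"
  shows "Metric_space.mtotally_bounded (mspace (funspace (mspace m) n))
           (mdist (funspace (mspace m) n)) S"
proof (rule totally_bounded_by_finite_codes[where 'c = "'a \<Rightarrow> 'b"])
  interpret M: Metric_space "mspace m" "mdist m" by (rule Metric_space_mspace_mdist)
  interpret N: Metric_space "mspace n" "mdist n" by (rule Metric_space_mspace_mdist)
  show "S \<subseteq> mspace (funspace (mspace m) n)" by (fact S(1))
  fix e :: real assume "0 < e"
  \<comment> \<open>Two maps with the same code are within \<open>4 * \<delta>\<close>: twice for moving to a point of the net, and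
    twice for rounding the values there.\<close>
  define \<delta> where "\<delta> = e / 5"
  have "0 < \<delta>" using \<open>0 < e\<close> by (simp add: \<delta>_def)
  obtain K where K: "finite K" "K \<subseteq> mspace m" "mspace m \<subseteq> (\<Union>x\<in>K. M.mball x \<delta>)"
    using m \<open>0 < \<delta>\<close> unfolding M.mtotally_bounded_def by meson
  obtain L where L: "finite L" "L \<subseteq> mspace n" "mspace n \<subseteq> (\<Union>x\<in>L. N.mball x \<delta>)"
    using n \<open>0 < \<delta>\<close> unfolding N.mtotally_bounded_def by meson
  have "\<forall>y\<in>mspace n. \<exists>x\<in>L. mdist n x y < \<delta>" using L(3) by fastforce
  then obtain r where r: "\<And>y. y \<in> mspace n \<Longrightarrow> r y \<in> L" "\<And>y. y \<in> mspace n \<Longrightarrow> mdist n (r y) y < \<delta>"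
    by metis
  define c where "c f = (\<lambda>x\<in>K. r (f x))" for f
  show "\<exists>c :: ('a \<Rightarrow> 'b) \<Rightarrow> 'a \<Rightarrow> 'b. finite (c ` S) \<and>
          (\<forall>f\<in>S. \<forall>h\<in>S. c f = c h \<longrightarrow> mdist (funspace (mspace m) n) f h < e)"
  proof (intro exI[of _ c] conjI ballI impI)
    have "c ` S \<subseteq> K \<rightarrow>\<^sub>E L"
      using nonexpansive_in[OF S(2)] K(2) r(1) by (auto simp: c_def)
    then show "finite (c ` S)"
      using K(1) L(1) by (meson finite_PiE finite_subset)
    fix f h assume fh: "f \<in> S" "h \<in> S" and eq: "c f = c h"
    have "mdist n (f x) (h x) \<le> 4 * \<delta>" if x: "x \<in> mspace m" for x
    proof -
      obtain k where k: "k \<in> K" "mdist m k x < \<delta>" using K(3) x by auto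
      have k': "k \<in> mspace m" using k K(2) by blast
      note in_n = nonexpansive_in[OF S(2)[OF fh(1)] x] nonexpansive_in[OF S(2)[OF fh(2)] x]
        nonexpansive_in[OF S(2)[OF fh(1)] k'] nonexpansive_in[OF S(2)[OF fh(2)] k']
      have "r (f k) = r (h k)"
        using eq[THEN fun_cong, of k] k(1) by (simp add: c_def)
      moreover have "r (f k) \<in> mspace n" using r(1) in_n(3) L(2) by blast
      ultimately have "mdist n (f k) (h k) \<le> 2 * \<delta>"
        using r(2)[OF in_n(3)] r(2)[OF in_n(4)] N.triangle[OF in_n(3) _ in_n(4), of "r (f k)"]
          N.commute[of "f k" "r (f k)"] by simp
      moreover have "mdist n (f x) (f k) \<le> \<delta>" "mdist n (h k) (h x) \<le> \<delta>"
        using nonexpansive_mdist[OF S(2)[OF fh(1)] x k'] nonexpansive_mdist[OF S(2)[OF fh(2)] k' x]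
          k(2) M.commute[of x k] by linarith+
      moreover have "mdist n (f x) (h x)
          \<le> mdist n (f x) (f k) + (mdist n (f k) (h k) + mdist n (h k) (h x))"
        using N.triangle[OF in_n(1) in_n(3) in_n(2)] N.triangle[OF in_n(3) in_n(4) in_n(2)] by linarith
      ultimately show ?thesis by linarith
    qed
    then have "mdist (funspace (mspace m) n) f h \<le> 4 * \<delta>"
      using funspace_mdist_le[of f "mspace m" n h] fh S(1) ne by blast
    then show "mdist (funspace (mspace m) n) f h < e"
      using \<open>0 < e\<close> by (simp add: \<delta>_def)
  qed
qed

section \<open>Extension from a dense subspace\<close>

locale dense_isometry =
  fixes m :: "'a metric" and m' :: "'b metric" and j :: "'a \<Rightarrow> 'b"
  assumes j_in: "\<And>x. x \<in> mspace m \<Longrightarrow> j x \<in> mspace m'"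
    and mdist_j: "\<And>x y. x \<in> mspace m \<Longrightarrow> y \<in> mspace m \<Longrightarrow> mdist m' (j x) (j y) = mdist m x y"
    and closure_j: "Abstract_Topology.closure_of (mtopology_of m') (j ` mspace m) = mspace m'"
begin

sublocale M: Metric_space "mspace m" "mdist m" by (rule Metric_space_mspace_mdist)
sublocale M': Metric_space "mspace m'" "mdist m'" by (rule Metric_space_mspace_mdist)

lemma inj_on_j: "inj_on j (mspace m)"
  by (rule inj_onI) (metis M.zero M'.zero j_in mdist_j)

lemma obtain_near:
  assumes "x \<in> mspace m'" "0 < e"
  obtains y where "y \<in> mspace m" "mdist m' x (j y) \<le> e"
  using assms closure_j in_closure_of_iff_mdist_le[of x m' "j ` mspace m"] by auto

lemma totally_bounded_dense:
  assumes "M.mtotally_bounded (mspace m)"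
  shows "M'.mtotally_bounded (mspace m')"
proof -
  have "nonexpansive m m' j" by (auto simp: nonexpansive_def j_in mdist_j)
  then have "M'.mtotally_bounded (j ` mspace m)"
    using mtotally_bounded_Cauchy_continuous_image nonexpansive_imp_Cauchy_continuous_map assms by blast
  from M'.mtotally_bounded_closure_of[OF this] show ?thesis
    using closure_j by (simp add: mtopology_of_def)
qed

text \<open>
  With \<open>c = 0\<close> this is the uniqueness of extensions; for general \<open>c\<close> it says that extending does
  not increase uniform distances.
\<close>

lemma mdist_le_by_density:
  assumes v: "nonexpansive m' n v" and w: "nonexpansive m' n w"
    and le: "\<And>x. x \<in> mspace m \<Longrightarrow> mdist n (v (j x)) (w (j x)) \<le> c"
    and x: "x \<in> mspace m'"
  shows "mdist n (v x) (w x) \<le> c"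
proof (rule field_le_epsilon)
  interpret N: Metric_space "mspace n" "mdist n" by (rule Metric_space_mspace_mdist)
  fix e :: real assume "0 < e"
  then obtain y where y: "y \<in> mspace m" "mdist m' x (j y) \<le> e / 2"
    using obtain_near[OF x, of "e / 2"] by auto
  note in_n = nonexpansive_in[OF v x] nonexpansive_in[OF w x]
    nonexpansive_in[OF v j_in[OF y(1)]] nonexpansive_in[OF w j_in[OF y(1)]]
  have "mdist n (v x) (w x)
      \<le> mdist n (v x) (v (j y)) + (mdist n (v (j y)) (w (j y)) + mdist n (w (j y)) (w x))"
    using N.triangle[OF in_n(1) in_n(3) in_n(2)] N.triangle[OF in_n(3) in_n(4) in_n(2)] by linarith
  then show "mdist n (v x) (w x) \<le> c + e"
    using le[OF y(1)] y(2) nonexpansive_mdist[OF v x j_in[OF y(1)]]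
      nonexpansive_mdist[OF w x j_in[OF y(1)]] N.commute[of "w (j y)" "w x"] by linarith
qed

lemma nonexpansive_eq_by_density:
  assumes v: "nonexpansive m' n v" "v \<in> extensional (mspace m')"
    and w: "nonexpansive m' n w" "w \<in> extensional (mspace m')"
    and eq: "\<And>x. x \<in> mspace m \<Longrightarrow> v (j x) = w (j x)"
  shows "v = w"
proof (rule extensionalityI[OF v(2) w(2)])
  interpret N: Metric_space "mspace n" "mdist n" by (rule Metric_space_mspace_mdist)
  fix x assume x: "x \<in> mspace m'"
  have "mdist n (v x) (w x) \<le> 0"
    using eq nonexpansive_in[OF w(1)] j_in
    by (intro mdist_le_by_density[OF v(1) w(1) _ x]) simp
  then show "v x = w x"
    using N.zero[OF nonexpansive_in[OF v(1) x] nonexpansive_in[OF w(1) x]] N.nonneg[of "v x" "w x"]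
    by linarith
qed

text \<open>
  A Lipschitz extension exists by completeness of the target. Its Lipschitz constant is then
  improved to 1 by comparing with nearby points of the dense subspace.
\<close>

lemma nonexpansive_extension_exists:
  assumes n: "mcomplete_of n" and u: "nonexpansive m n u"
  shows "\<exists>v. nonexpansive m' n v \<and> v \<in> extensional (mspace m') \<and> (\<forall>x\<in>mspace m. v (j x) = u x)"
proof -
  interpret N: Metric_space "mspace n" "mdist n" by (rule Metric_space_mspace_mdist)
  let ?S = "j ` mspace m" and ?u = "\<lambda>y. u (inv_into (mspace m) j y)"
  have u_j: "?u (j x) = u x" if "x \<in> mspace m" for x
    using inv_into_f_f[OF inj_on_j that] by simp
  have "Lipschitz_continuous_map (submetric m' ?S) n ?u"
    unfolding Lipschitz_continuous_map_def
    using u_j nonexpansive_in[OF u] nonexpansive_mdist[OF u] mdist_j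
    by (intro conjI exI[of _ 1]) auto
  then obtain v where v: "Lipschitz_continuous_map m' n v" "\<And>x. x \<in> mspace m \<Longrightarrow> v (j x) = u x"
    using Lipschitz_continuous_map_extends_to_closure_of[OF n, of m' ?S ?u]
    unfolding closure_j submetric_mspace by (metis imageI u_j)
  then obtain C where C: "0 < C"
      "\<And>x y. x \<in> mspace m' \<Longrightarrow> y \<in> mspace m' \<Longrightarrow> mdist n (v x) (v y) \<le> C * mdist m' x y"
    and v_in: "v \<in> mspace m' \<rightarrow> mspace n"
    unfolding Lipschitz_continuous_map_pos by auto
  have "nonexpansive m' n v"
    unfolding nonexpansive_def
  proof (intro conjI ballI v_in)
    fix x y assume xy: "x \<in> mspace m'" "y \<in> mspace m'"
    show "mdist n (v x) (v y) \<le> mdist m' x y"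
    proof (rule field_le_epsilon)
      fix e :: real assume "0 < e"
      \<comment> \<open>Moving \<open>x\<close> and \<open>y\<close> by \<open>\<delta>\<close> costs \<open>2 * \<delta>\<close> in the domain and \<open>2 * C * \<delta>\<close> in the codomain.\<close>
      define \<delta> where "\<delta> = e / (2 * (C + 1))"
      have "0 < \<delta>" using \<open>0 < e\<close> C(1) by (simp add: \<delta>_def)
      obtain a where a: "a \<in> mspace m" "mdist m' x (j a) \<le> \<delta>" using obtain_near[OF xy(1) \<open>0 < \<delta>\<close>] .
      obtain b where b: "b \<in> mspace m" "mdist m' y (j b) \<le> \<delta>" using obtain_near[OF xy(2) \<open>0 < \<delta>\<close>] .
      note ja = j_in[OF a(1)] and jb = j_in[OF b(1)]
      have vs: "v x \<in> mspace n" "v y \<in> mspace n" "v (j a) \<in> mspace n" "v (j b) \<in> mspace n"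
        using v_in xy ja jb by auto
      have "mdist n (v x) (v (j a)) \<le> C * \<delta>" "mdist n (v (j b)) (v y) \<le> C * \<delta>"
        using C(2)[OF xy(1) ja] C(2)[OF xy(2) jb] mult_left_mono[OF a(2), of C] mult_left_mono[OF b(2), of C]
          C(1) N.commute[of "v y" "v (j b)"] by linarith+
      moreover have "mdist n (v (j a)) (v (j b)) \<le> mdist m a b"
        using nonexpansive_mdist[OF u a(1) b(1)] v(2)[OF a(1)] v(2)[OF b(1)] by simp
      moreover have "mdist m a b \<le> mdist m' x y + 2 * \<delta>"
        using M'.triangle[OF ja xy(1) jb] M'.triangle[OF xy jb] a(2) b(2) mdist_j[OF a(1) b(1)]
          M'.commute[of "j a" x] by linarith
      moreover have "mdist n (v x) (v y)
          \<le> mdist n (v x) (v (j a)) + (mdist n (v (j a)) (v (j b)) + mdist n (v (j b)) (v y))"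
        using N.triangle[OF vs(1) vs(3) vs(2)] N.triangle[OF vs(3) vs(4) vs(2)] by linarith
      moreover have "2 * (C * \<delta>) + 2 * \<delta> = e"
      proof -
        have "\<delta> * (2 * (C + 1)) = e" using C(1) by (simp add: \<delta>_def)
        then show ?thesis by (simp add: algebra_simps)
      qed
      ultimately show "mdist n (v x) (v y) \<le> mdist m' x y + e" by linarith
    qed
  qed
  then have "nonexpansive m' n (restrict v (mspace m'))"
    by (auto simp: nonexpansive_def)
  then show ?thesis
    using v(2) j_in by (intro exI[of _ "restrict v (mspace m')"]) auto
qed

definition extension :: "'c metric \<Rightarrow> ('a \<Rightarrow> 'c) \<Rightarrow> 'b \<Rightarrow> 'c" where
  "extension n u = (SOME v. nonexpansive m' n v \<and> v \<in> extensional (mspace m') \<and>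
                            (\<forall>x\<in>mspace m. v (j x) = u x))"

lemma
  assumes "mcomplete_of n" "nonexpansive m n u"
  shows nonexpansive_extension: "nonexpansive m' n (extension n u)"
    and extension_extensional: "extension n u \<in> extensional (mspace m')"
    and extension_j: "x \<in> mspace m \<Longrightarrow> extension n u (j x) = u x"
  using someI_ex[OF nonexpansive_extension_exists[OF assms]] unfolding extension_def by blast+

end


section \<open>The metric space of points\<close>

definition point_metric :: "'a set \<Rightarrow> ('a \<Rightarrow> real) set \<Rightarrow> 'a metric" where
  "point_metric X \<Phi> = metric (X, \<lambda>x y. enn2real (point_dist \<Phi> x y))"

lemma
  assumes "is_metric X (point_dist \<Phi>)"
  shows mspace_point_metric: "mspace (point_metric X \<Phi>) = X"
    and mdist_point_metric: "mdist (point_metric X \<Phi>) x y = enn2real (point_dist \<Phi> x y)"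
  using assms
  by (simp_all add: point_metric_def is_metric_def Metric_space.mspace_metric Metric_space.mdist_metric)

lemma point_dist_eq_mdist:
  assumes "is_metric X (point_dist \<Phi>)" "x \<in> X" "y \<in> X"
  shows "point_dist \<Phi> x y = ennreal (mdist (point_metric X \<Phi>) x y)"
  using assms unfolding mdist_point_metric[OF assms(1)] by (simp add: is_metric_def)

lemma mdist_point_metric_le_iff:
  assumes "is_metric X (point_dist \<Phi>)" "x \<in> X" "y \<in> X" "0 \<le> c"
  shows "mdist (point_metric X \<Phi>) x y \<le> c \<longleftrightarrow> (\<forall>\<phi>\<in>\<Phi>. \<bar>\<phi> x - \<phi> y\<bar> \<le> c)"
  using point_dist_le_iff[OF assms(4), of \<Phi> x y] point_dist_eq_mdist[OF assms(1-3)] assms(4) by simp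

text \<open>
  If two points have the same rounded values for all functions of a finite net of \<open>\<Phi>\<close>, then no
  function of \<open>\<Phi>\<close> separates them by much. Since the functions are bounded, only finitely many
  rounded values occur.
\<close>

lemma totally_bounded_point_metric:
  assumes ds: "data_set X \<Phi>" and met: "is_metric X (point_dist \<Phi>)"
    and tb: "Metric_space.mtotally_bounded (mspace (data_metric X \<Phi>)) (mdist (data_metric X \<Phi>)) \<Phi>"
  shows "Metric_space.mtotally_bounded (mspace (point_metric X \<Phi>)) (mdist (point_metric X \<Phi>)) X"
proof (rule totally_bounded_by_finite_codes[where 'c = "('a \<Rightarrow> real) \<Rightarrow> int"])
  interpret D: Metric_space "mspace (data_metric X \<Phi>)" "mdist (data_metric X \<Phi>)"
    by (rule Metric_space_mspace_mdist)
  show "X \<subseteq> mspace (point_metric X \<Phi>)" by (simp add: mspace_point_metric[OF met])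
  fix e :: real assume "0 < e"
  \<comment> \<open>The bound obtained below is \<open>3 * \<delta>\<close>: twice for replacing a function by one of the net, once
    for rounding.\<close>
  define \<delta> where "\<delta> = e / 4"
  have "0 < \<delta>" using \<open>0 < e\<close> by (simp add: \<delta>_def)
  obtain F where F: "finite F" "F \<subseteq> \<Phi>" "\<Phi> \<subseteq> (\<Union>\<phi>\<in>F. D.mball \<phi> \<delta>)"
    using tb \<open>0 < \<delta>\<close> unfolding D.mtotally_bounded_def by meson
  define c where "c x = (\<lambda>\<phi>\<in>F. \<lfloor>\<phi> x / \<delta>\<rfloor>)" for x
  show "\<exists>c :: 'a \<Rightarrow> ('a \<Rightarrow> real) \<Rightarrow> int. finite (c ` X) \<and>
          (\<forall>x\<in>X. \<forall>y\<in>X. c x = c y \<longrightarrow> mdist (point_metric X \<Phi>) x y < e)"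
  proof (intro exI[of _ c] conjI ballI impI)
    have "\<exists>B. \<forall>x\<in>X. \<bar>\<phi> x\<bar> \<le> B" if "\<phi> \<in> F" for \<phi>
    proof -
      have "\<phi> \<in> mspace (bounded_functions X)" using ds F(2) that unfolding data_set_def by blast
      then show ?thesis unfolding mspace_bounded_functions bounded_iff by auto
    qed
    then obtain B where B: "\<And>\<phi> x. \<phi> \<in> F \<Longrightarrow> x \<in> X \<Longrightarrow> \<bar>\<phi> x\<bar> \<le> B \<phi>" by metis
    have "\<lfloor>\<phi> x / \<delta>\<rfloor> \<in> {\<lfloor>- B \<phi> / \<delta>\<rfloor>..\<lfloor>B \<phi> / \<delta>\<rfloor>}" if "\<phi> \<in> F" "x \<in> X" for \<phi> x
    proof -
      have "- B \<phi> \<le> \<phi> x" "\<phi> x \<le> B \<phi>" using B[OF that] by linarith+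
      then have "- B \<phi> / \<delta> \<le> \<phi> x / \<delta>" "\<phi> x / \<delta> \<le> B \<phi> / \<delta>"
        using \<open>0 < \<delta>\<close> by (intro divide_right_mono; simp)+
      then show ?thesis by (simp add: floor_mono)
    qed
    then have "c ` X \<subseteq> (\<Pi>\<^sub>E \<phi>\<in>F. {\<lfloor>- B \<phi> / \<delta>\<rfloor>..\<lfloor>B \<phi> / \<delta>\<rfloor>})"
      unfolding c_def by (intro image_subsetI restrict_PiE_iff[THEN iffD2] ballI)
    then show "finite (c ` X)"
      using finite_PiE[OF F(1)] by (rule finite_subset) simp
    fix x y assume xy: "x \<in> X" "y \<in> X" and eq: "c x = c y"
    have "\<bar>\<psi> x - \<psi> y\<bar> \<le> 3 * \<delta>" if \<psi>: "\<psi> \<in> \<Phi>" for \<psi>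
    proof -
      obtain \<phi> where \<phi>: "\<phi> \<in> F" "mdist (data_metric X \<Phi>) \<phi> \<psi> < \<delta>"
        using F(3) \<psi> by auto
      have \<phi>': "\<phi> \<in> \<Phi>" using \<phi>(1) F(2) by blast
      have near: "\<bar>\<phi> z - \<psi> z\<bar> \<le> \<delta>" if "z \<in> X" for z
        using mdist_data_metric_le_iff[OF ds \<phi>' \<psi>, of \<delta>] \<phi>(2) that by simp
      have "\<lfloor>\<phi> x / \<delta>\<rfloor> = \<lfloor>\<phi> y / \<delta>\<rfloor>"
        using eq[THEN fun_cong, of \<phi>] \<phi>(1) by (simp add: c_def)
      then have "\<bar>\<phi> x / \<delta> - \<phi> y / \<delta>\<bar> \<le> 1" by linarith
      then have "\<bar>\<phi> x - \<phi> y\<bar> \<le> \<delta>"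
        using \<open>0 < \<delta>\<close> by (simp add: abs_le_iff field_simps)
      then show ?thesis using near[OF xy(1)] near[OF xy(2)] by linarith
    qed
    then have "mdist (point_metric X \<Phi>) x y \<le> 3 * \<delta>"
      using mdist_point_metric_le_iff[OF met xy, of "3 * \<delta>"] \<open>0 < \<delta>\<close> by simp
    then show "mdist (point_metric X \<Phi>) x y < e" using \<open>0 < e\<close> by (simp add: \<delta>_def)
  qed
qed

lemma data_set_imp_nonexpansive:
  assumes "is_metric X (point_dist \<Phi>)" "\<phi> \<in> \<Phi>"
  shows "nonexpansive (point_metric X \<Phi>) euclidean_metric \<phi>"
  unfolding nonexpansive_def mspace_point_metric[OF assms(1)]
proof (intro conjI ballI)
  fix x y assume xy: "x \<in> X" "y \<in> X"
  have "\<bar>\<phi> x - \<phi> y\<bar> \<le> mdist (point_metric X \<Phi>) x y"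
    by (rule mdist_point_metric_le_iff[OF assms(1) xy mdist_nonneg, THEN iffD1, OF order_refl, THEN bspec])
      (fact assms(2))
  then show "mdist euclidean_metric (\<phi> x) (\<phi> y) \<le> mdist (point_metric X \<Phi>) x y"
    by (simp add: dist_real_def)
qed simp

text \<open>
  The functions \<open>\<phi> \<circ> g\<close> that bound the distance of \<open>g x\<close> and \<open>g y\<close> are among those that define the
  distance of \<open>x\<close> and \<open>y\<close>.
\<close>

lemma perception_pair_imp_nonexpansive:
  assumes pp: "perception_pair X \<Phi> G" and met: "is_metric X (point_dist \<Phi>)" and g: "g \<in> G"
  shows "nonexpansive (point_metric X \<Phi>) (point_metric X \<Phi>) g"
  unfolding nonexpansive_def mspace_point_metric[OF met]
proof (intro conjI ballI)
  have g_in: "g \<in> X \<rightarrow> X" and act: "\<And>\<phi>. \<phi> \<in> \<Phi> \<Longrightarrow> compose X \<phi> g \<in> \<Phi>"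
    using pp g by (auto simp: perception_pair_iff)
  then show "g \<in> X \<rightarrow> X" by blast
  fix x y assume xy: "x \<in> X" "y \<in> X"
  then have gxy: "g x \<in> X" "g y \<in> X" using g_in by auto
  have "\<bar>\<phi> (g x) - \<phi> (g y)\<bar> \<le> mdist (point_metric X \<Phi>) x y" if "\<phi> \<in> \<Phi>" for \<phi>
    using nonexpansive_mdist[OF data_set_imp_nonexpansive[OF met act[OF that]], of x y] xy
    by (simp add: mspace_point_metric[OF met] compose_eq dist_real_def)
  then show "mdist (point_metric X \<Phi>) (g x) (g y) \<le> mdist (point_metric X \<Phi>) x y"
    by (intro mdist_point_metric_le_iff[OF met gxy mdist_nonneg, THEN iffD2] ballI)
qed


section \<open>The completion of a perception pair\<close>

text \<open>
  \<open>X'\<close> is the completion as a metric space; its underlying set is written \<open>X\<^sub>c\<close>.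
\<close>

locale completed_pair = dense_isometry "point_metric X \<Phi>" X' j
  for X :: "'a set" and \<Phi> :: "('a \<Rightarrow> real) set" and X' :: "'b metric" and j :: "'a \<Rightarrow> 'b" +
  fixes G :: "('a \<Rightarrow> 'a) set"
  assumes pair: "perception_pair X \<Phi> G"
    and tb_data: "Metric_space.mtotally_bounded (mspace (data_metric X \<Phi>)) (mdist (data_metric X \<Phi>)) \<Phi>"
    and metric_points: "is_metric X (point_dist \<Phi>)"
    and complete: "mcomplete_of X'"
begin

abbreviation "P \<equiv> point_metric X \<Phi>"
abbreviation "X\<^sub>c \<equiv> mspace X'"

lemma mspace_P [simp]: "mspace P = X"
  by (rule mspace_point_metric[OF metric_points])

lemma data_set_X: "data_set X \<Phi>"
  and G_fun: "g \<in> G \<Longrightarrow> g \<in> X \<rightarrow>\<^sub>E X"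
  and G_one: "(\<lambda>x\<in>X. x) \<in> G"
  and G_mult: "g \<in> G \<Longrightarrow> h \<in> G \<Longrightarrow> compose X g h \<in> G"
  and G_inv: "g \<in> G \<Longrightarrow> \<exists>h\<in>G. compose X g h = (\<lambda>x\<in>X. x) \<and> compose X h g = (\<lambda>x\<in>X. x)"
  and G_act: "\<phi> \<in> \<Phi> \<Longrightarrow> g \<in> G \<Longrightarrow> compose X \<phi> g \<in> \<Phi>"
  using pair unfolding perception_pair_iff by (simp_all add: subset_iff)

lemma G_in: "g \<in> G \<Longrightarrow> x \<in> X \<Longrightarrow> g x \<in> X"
  using G_fun by blast

lemma X_nonempty: "X \<noteq> {}"
  using data_set_X by (simp add: data_set_def)

lemma X'_nonempty: "X\<^sub>c \<noteq> {}"
  using X_nonempty j_in by auto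

lemma totally_bounded_X': "M'.mtotally_bounded X\<^sub>c"
  using totally_bounded_dense totally_bounded_point_metric[OF data_set_X metric_points tb_data] by simp

text \<open>
  Boundedness, which elements of a \<open>funspace\<close> must satisfy, is automatic for self-maps of the
  totally bounded space \<open>X'\<close>.
\<close>

lemma in_funspace_X'_iff: "g \<in> mspace (funspace X\<^sub>c X') \<longleftrightarrow> g \<in> X\<^sub>c \<rightarrow>\<^sub>E X\<^sub>c"
proof -
  have "M'.mbounded (g ` X\<^sub>c)" if "g \<in> X\<^sub>c \<rightarrow> X\<^sub>c"
    using M'.mbounded_subset[OF M'.mtotally_bounded_imp_mbounded[OF totally_bounded_X']] that by blast
  then show ?thesis
    by (auto simp: M'.fspace_def PiE_def image_subset_iff_funcset)
qed

definition lift_data :: "('a \<Rightarrow> real) \<Rightarrow> 'b \<Rightarrow> real" where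
  "lift_data \<phi> = extension euclidean_metric \<phi>"

definition lift_aut :: "('a \<Rightarrow> 'a) \<Rightarrow> 'b \<Rightarrow> 'b" where
  "lift_aut g = extension X' (compose X j g)"

lemma complete_real: "mcomplete_of (euclidean_metric :: real metric)"
  by (simp add: euclidean_metric_def mcomplete_of_def complete_UNIV)

lemma
  assumes "\<phi> \<in> \<Phi>"
  shows nonexpansive_lift_data: "nonexpansive X' euclidean_metric (lift_data \<phi>)"
    and lift_data_extensional: "lift_data \<phi> \<in> extensional X\<^sub>c"
    and lift_data_j: "x \<in> X \<Longrightarrow> lift_data \<phi> (j x) = \<phi> x"
  using nonexpansive_extension[OF complete_real] extension_extensional[OF complete_real]
    extension_j[OF complete_real] data_set_imp_nonexpansive[OF metric_points assms]
  unfolding lift_data_def by simp_all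

lemma
  assumes "g \<in> G"
  shows nonexpansive_lift_aut: "nonexpansive X' X' (lift_aut g)"
    and lift_aut_extensional: "lift_aut g \<in> extensional X\<^sub>c"
    and lift_aut_j: "x \<in> X \<Longrightarrow> lift_aut g (j x) = j (g x)"
proof -
  have "nonexpansive P X' j" using j_in mdist_j by (auto simp: nonexpansive_def)
  then have "nonexpansive P X' (compose X j g)"
    using nonexpansive_compose[OF perception_pair_imp_nonexpansive[OF pair metric_points assms]]
    by simp
  then show "nonexpansive X' X' (lift_aut g)" "lift_aut g \<in> extensional X\<^sub>c"
    "x \<in> X \<Longrightarrow> lift_aut g (j x) = j (g x)"
    using nonexpansive_extension[OF complete] extension_extensional[OF complete]
      extension_j[OF complete] unfolding lift_aut_def by (simp_all add: compose_eq)
qed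

lemma lift_aut_in: "g \<in> G \<Longrightarrow> x \<in> X\<^sub>c \<Longrightarrow> lift_aut g x \<in> X\<^sub>c"
  using nonexpansive_in[OF nonexpansive_lift_aut] .

lemma lift_aut_compose:
  assumes "g \<in> G" "h \<in> G"
  shows "lift_aut (compose X g h) = compose X\<^sub>c (lift_aut g) (lift_aut h)"
proof (rule nonexpansive_eq_by_density)
  show "nonexpansive X' X' (compose X\<^sub>c (lift_aut g) (lift_aut h))"
    using nonexpansive_compose[OF nonexpansive_lift_aut[OF assms(2)] nonexpansive_lift_aut[OF assms(1)]] .
  show "lift_aut (compose X g h) (j x) = compose X\<^sub>c (lift_aut g) (lift_aut h) (j x)"
    if "x \<in> mspace P" for x
    using that assms j_in[OF that] lift_aut_j[OF G_mult[OF assms]]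
    by (simp add: compose_eq lift_aut_j G_in)
qed (simp_all add: nonexpansive_lift_aut lift_aut_extensional G_mult assms)

lemma lift_aut_one: "lift_aut (\<lambda>x\<in>X. x) = (\<lambda>x\<in>X\<^sub>c. x)"
proof (rule nonexpansive_eq_by_density)
  show "nonexpansive X' X' (\<lambda>x\<in>X\<^sub>c. x)" by (auto simp: nonexpansive_def)
  show "lift_aut (\<lambda>x\<in>X. x) (j x) = (\<lambda>x\<in>X\<^sub>c. x) (j x)" if "x \<in> mspace P" for x
    using that j_in[OF that] lift_aut_j[OF G_one] by simp
qed (simp_all add: nonexpansive_lift_aut lift_aut_extensional G_one)

lemma lift_data_compose:
  assumes "\<phi> \<in> \<Phi>" "g \<in> G"
  shows "lift_data (compose X \<phi> g) = compose X\<^sub>c (lift_data \<phi>) (lift_aut g)"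
proof (rule nonexpansive_eq_by_density)
  show "nonexpansive X' euclidean_metric (compose X\<^sub>c (lift_data \<phi>) (lift_aut g))"
    using nonexpansive_compose[OF nonexpansive_lift_aut[OF assms(2)] nonexpansive_lift_data[OF assms(1)]] .
  show "lift_data (compose X \<phi> g) (j x) = compose X\<^sub>c (lift_data \<phi>) (lift_aut g) (j x)"
    if "x \<in> mspace P" for x
    using that assms j_in[OF that] lift_data_j[OF G_act[OF assms]]
    by (simp add: compose_eq lift_aut_j lift_data_j G_in)
qed (simp_all add: nonexpansive_lift_data lift_data_extensional G_act assms)

lemma lift_aut_inverse:
  assumes "g \<in> G"
  shows "\<exists>h\<in>G. \<forall>x\<in>X\<^sub>c. lift_aut g (lift_aut h x) = x \<and> lift_aut h (lift_aut g x) = x"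
proof -
  obtain h where h: "h \<in> G" "compose X g h = (\<lambda>x\<in>X. x)" "compose X h g = (\<lambda>x\<in>X. x)"
    using G_inv[OF assms] by blast
  have "compose X\<^sub>c (lift_aut g) (lift_aut h) = (\<lambda>x\<in>X\<^sub>c. x)"
    "compose X\<^sub>c (lift_aut h) (lift_aut g) = (\<lambda>x\<in>X\<^sub>c. x)"
    using lift_aut_compose[OF assms h(1)] lift_aut_compose[OF h(1) assms] h(2,3) lift_aut_one by simp_all
  then have "lift_aut g (lift_aut h x) = x" "lift_aut h (lift_aut g x) = x" if "x \<in> X\<^sub>c" for x
    using that by (metis compose_eq restrict_apply')+
  then show ?thesis using h(1) by blast
qed

lemma mdist_lift_aut:
  assumes "g \<in> G" "x \<in> X\<^sub>c" "y \<in> X\<^sub>c"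
  shows "mdist X' (lift_aut g x) (lift_aut g y) = mdist X' x y"
proof (rule antisym)
  show "mdist X' (lift_aut g x) (lift_aut g y) \<le> mdist X' x y"
    using nonexpansive_mdist[OF nonexpansive_lift_aut] assms .
  obtain h where h: "h \<in> G" "\<And>x. x \<in> X\<^sub>c \<Longrightarrow> lift_aut g (lift_aut h x) = x"
    "\<And>x. x \<in> X\<^sub>c \<Longrightarrow> lift_aut h (lift_aut g x) = x"
    using lift_aut_inverse[OF assms(1)] by blast
  show "mdist X' x y \<le> mdist X' (lift_aut g x) (lift_aut g y)"
    using nonexpansive_mdist[OF nonexpansive_lift_aut[OF h(1)], of "lift_aut g x" "lift_aut g y"]
      assms h(3) by (simp add: lift_aut_in)
qed

lemma lift_data_near_iff:
  assumes "\<phi> \<in> \<Phi>" "\<psi> \<in> \<Phi>"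
  shows "(\<forall>x\<in>X\<^sub>c. \<bar>lift_data \<phi> x - lift_data \<psi> x\<bar> \<le> c) \<longleftrightarrow> mdist (data_metric X \<Phi>) \<phi> \<psi> \<le> c"
proof -
  have "(\<forall>x\<in>X\<^sub>c. \<bar>lift_data \<phi> x - lift_data \<psi> x\<bar> \<le> c) \<longleftrightarrow> (\<forall>x\<in>X. \<bar>\<phi> x - \<psi> x\<bar> \<le> c)"
  proof
    show "\<forall>x\<in>X. \<bar>\<phi> x - \<psi> x\<bar> \<le> c" if "\<forall>x\<in>X\<^sub>c. \<bar>lift_data \<phi> x - lift_data \<psi> x\<bar> \<le> c"
      using that j_in lift_data_j assms by fastforce
    show "\<forall>x\<in>X\<^sub>c. \<bar>lift_data \<phi> x - lift_data \<psi> x\<bar> \<le> c" if "\<forall>x\<in>X. \<bar>\<phi> x - \<psi> x\<bar> \<le> c"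
      using mdist_le_by_density[OF nonexpansive_lift_data[OF assms(1)] nonexpansive_lift_data[OF assms(2)], of c]
        that lift_data_j assms by (simp add: dist_real_def)
  qed
  then show ?thesis using mdist_data_metric_le_iff[OF data_set_X assms] by simp
qed

subsection \<open>Closing up the extended functions and automorphisms\<close>

abbreviation "real_functions \<equiv> funspace X\<^sub>c (euclidean_metric :: real metric)"
abbreviation "self_maps \<equiv> funspace X\<^sub>c X'"

definition \<Phi>' :: "('b \<Rightarrow> real) set" where
  "\<Phi>' = Abstract_Topology.closure_of (mtopology_of real_functions) (lift_data ` \<Phi>)"

definition G' :: "('b \<Rightarrow> 'b) set" where
  "G' = Abstract_Topology.closure_of (mtopology_of self_maps) (lift_aut ` G)"

lemma lift_data_in_funspace: "lift_data ` \<Phi> \<subseteq> mspace real_functions"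
proof -
  have "bounded (lift_data \<phi> ` X\<^sub>c)" if "\<phi> \<in> \<Phi>" for \<phi>
    using mtotally_bounded_Cauchy_continuous_image[OF nonexpansive_imp_Cauchy_continuous_map
        [OF nonexpansive_lift_data[OF that]] totally_bounded_X']
      Met_TC.mtotally_bounded_imp_mbounded by simp
  then show ?thesis
    using lift_data_extensional unfolding mspace_bounded_functions by blast
qed

lemma lift_aut_in_funspace: "lift_aut ` G \<subseteq> mspace self_maps"
  unfolding in_funspace_X'_iff subset_iff using lift_aut_in lift_aut_extensional by (auto simp: PiE_def)

lemma in_\<Phi>'_iff: "\<psi> \<in> \<Phi>' \<longleftrightarrow> \<psi> \<in> mspace real_functions \<and>
    (\<forall>e>0. \<exists>\<phi>\<in>\<Phi>. \<forall>x\<in>X\<^sub>c. \<bar>\<psi> x - lift_data \<phi> x\<bar> \<le> e)"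
  unfolding \<Phi>'_def in_closure_of_funspace_iff[OF X'_nonempty lift_data_in_funspace]
  by (simp add: dist_real_def)

lemma in_G'_iff: "g \<in> G' \<longleftrightarrow> g \<in> X\<^sub>c \<rightarrow>\<^sub>E X\<^sub>c \<and>
    (\<forall>e>0. \<exists>g\<^sub>0\<in>G. \<forall>x\<in>X\<^sub>c. mdist X' (g x) (lift_aut g\<^sub>0 x) \<le> e)"
  unfolding G'_def in_closure_of_funspace_iff[OF X'_nonempty lift_aut_in_funspace] in_funspace_X'_iff
  by simp

lemma lift_data_in: "\<phi> \<in> \<Phi> \<Longrightarrow> lift_data \<phi> \<in> \<Phi>'"
  using lift_data_in_funspace closure_of_subset[of "lift_data ` \<Phi>" "mtopology_of real_functions"]
  unfolding \<Phi>'_def topspace_mtopology_of by blast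

lemma lift_aut_in_G': "g \<in> G \<Longrightarrow> lift_aut g \<in> G'"
  using lift_aut_in_funspace closure_of_subset[of "lift_aut ` G" "mtopology_of self_maps"]
  unfolding G'_def topspace_mtopology_of by blast

lemma nonexpansive_\<Phi>':
  assumes "\<psi> \<in> \<Phi>'"
  shows "nonexpansive X' euclidean_metric \<psi>"
proof (rule nonexpansive_uniform_limit)
  fix e :: real assume "0 < e"
  then obtain \<phi> where "\<phi> \<in> \<Phi>" "\<forall>x\<in>X\<^sub>c. \<bar>\<psi> x - lift_data \<phi> x\<bar> \<le> e"
    using assms unfolding in_\<Phi>'_iff by blast
  then show "\<exists>s. nonexpansive X' euclidean_metric s \<and> (\<forall>x\<in>X\<^sub>c. mdist euclidean_metric (\<psi> x) (s x) \<le> e)"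
    using nonexpansive_lift_data by (auto simp: dist_real_def)
qed simp

lemma G'_fun: "g \<in> G' \<Longrightarrow> g \<in> X\<^sub>c \<rightarrow>\<^sub>E X\<^sub>c"
  by (simp add: in_G'_iff)

lemma G'_in: "g \<in> G' \<Longrightarrow> x \<in> X\<^sub>c \<Longrightarrow> g x \<in> X\<^sub>c"
  using G'_fun by blast

lemma G'_approx:
  assumes "g \<in> G'" "0 < e"
  shows "\<exists>g\<^sub>0\<in>G. \<forall>x\<in>X\<^sub>c. mdist X' (g x) (lift_aut g\<^sub>0 x) \<le> e"
  using assms unfolding in_G'_iff by blast

lemma \<Phi>'_approx:
  assumes "\<psi> \<in> \<Phi>'" "0 < e"
  shows "\<exists>\<phi>\<in>\<Phi>. \<forall>x\<in>X\<^sub>c. \<bar>\<psi> x - lift_data \<phi> x\<bar> \<le> e"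
  using assms unfolding in_\<Phi>'_iff by blast

lemma nonexpansive_G':
  assumes "g \<in> G'"
  shows "nonexpansive X' X' g"
proof (rule nonexpansive_uniform_limit)
  show "g \<in> X\<^sub>c \<rightarrow> X\<^sub>c" using G'_fun[OF assms] by blast
  fix e :: real assume "0 < e"
  then show "\<exists>s. nonexpansive X' X' s \<and> (\<forall>x\<in>X\<^sub>c. mdist X' (g x) (s x) \<le> e)"
    using G'_approx[OF assms, of e] nonexpansive_lift_aut by metis
qed

lemma data_set_\<Phi>': "data_set X\<^sub>c \<Phi>'"
  unfolding data_set_def using X'_nonempty in_\<Phi>'_iff by blast

text \<open>
  Nonexpansiveness of the functions in \<open>\<Phi>'\<close> gives one inequality. For the other, any bound for
  \<open>\<Phi>'\<close> at \<open>x\<close> and \<open>y\<close> is nearly a bound for \<open>\<Phi>\<close> at points of \<open>X\<close> close to them, and hence for the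
  distance of these points.
\<close>

lemma point_dist_\<Phi>':
  assumes x: "x \<in> X\<^sub>c" and y: "y \<in> X\<^sub>c"
  shows "point_dist \<Phi>' x y = ennreal (mdist X' x y)"
proof (rule ennreal_eq_by_real_bounds)
  fix c :: real assume "0 \<le> c"
  have "(\<forall>\<psi>\<in>\<Phi>'. \<bar>\<psi> x - \<psi> y\<bar> \<le> c) \<longleftrightarrow> mdist X' x y \<le> c"
  proof (intro iffI ballI)
    fix \<psi> assume "mdist X' x y \<le> c" "\<psi> \<in> \<Phi>'"
    then show "\<bar>\<psi> x - \<psi> y\<bar> \<le> c"
      using nonexpansive_mdist[OF nonexpansive_\<Phi>' x y, of \<psi>] by (simp add: dist_real_def)
  next
    assume le: "\<forall>\<psi>\<in>\<Phi>'. \<bar>\<psi> x - \<psi> y\<bar> \<le> c"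
    show "mdist X' x y \<le> c"
    proof (rule field_le_epsilon)
      fix e :: real assume "0 < e"
      then have "0 < e / 4" by simp
      obtain a where a: "a \<in> X" "mdist X' x (j a) \<le> e / 4" using obtain_near[OF x \<open>0 < e / 4\<close>] by auto
      obtain b where b: "b \<in> X" "mdist X' y (j b) \<le> e / 4" using obtain_near[OF y \<open>0 < e / 4\<close>] by auto
      have ja: "j a \<in> X\<^sub>c" and jb: "j b \<in> X\<^sub>c" using j_in a b by auto
      have "\<bar>\<phi> a - \<phi> b\<bar> \<le> c + e / 2" if \<phi>: "\<phi> \<in> \<Phi>" for \<phi>
      proof -
        have "\<bar>lift_data \<phi> x - lift_data \<phi> y\<bar> \<le> c" using le lift_data_in[OF \<phi>] by blast
        moreover have "\<bar>lift_data \<phi> x - lift_data \<phi> (j a)\<bar> \<le> e / 4"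
          "\<bar>lift_data \<phi> y - lift_data \<phi> (j b)\<bar> \<le> e / 4"
          using nonexpansive_mdist[OF nonexpansive_lift_data[OF \<phi>] x ja]
            nonexpansive_mdist[OF nonexpansive_lift_data[OF \<phi>] y jb] a b by (simp_all add: dist_real_def)
        ultimately show ?thesis
          using lift_data_j[OF \<phi> a(1)] lift_data_j[OF \<phi> b(1)] by linarith
      qed
      then have "mdist P a b \<le> c + e / 2"
        using mdist_point_metric_le_iff[OF metric_points a(1) b(1), of "c + e / 2"] \<open>0 < e\<close> \<open>0 \<le> c\<close> by simp
      then show "mdist X' x y \<le> c + e"
        using M'.triangle[OF x ja y] M'.triangle[OF ja jb y] a b M'.commute[of y "j b"] mdist_j[of a b]
        by simp
    qed
  qed
  then show "point_dist \<Phi>' x y \<le> ennreal c \<longleftrightarrow> ennreal (mdist X' x y) \<le> ennreal c"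
    using \<open>0 \<le> c\<close> by (simp add: point_dist_le_iff)
qed

subsection \<open>The group of limit isometries\<close>

text \<open>
  \<open>\<psi> \<circ> g\<close> is approximated by the extension of \<open>\<phi> \<circ> g\<^sub>0\<close> when \<open>\<phi>\<close> approximates \<open>\<psi>\<close> and \<open>g\<^sub>0\<close> approximates
  \<open>g\<close>: nonexpansiveness of the extended \<open>\<phi>\<close> makes the errors add up.
\<close>

lemma G'_act:
  assumes \<psi>: "\<psi> \<in> \<Phi>'" and g: "g \<in> G'"
  shows "compose X\<^sub>c \<psi> g \<in> \<Phi>'"
  unfolding in_\<Phi>'_iff
proof (intro conjI allI impI)
  have "bounded (\<psi> ` X\<^sub>c)"
    using \<psi> unfolding in_\<Phi>'_iff mspace_bounded_functions by blast
  then have "bounded (compose X\<^sub>c \<psi> g ` X\<^sub>c)"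
    by (rule bounded_subset) (auto simp: compose_eq G'_in[OF g])
  then show "compose X\<^sub>c \<psi> g \<in> mspace real_functions"
    unfolding mspace_bounded_functions by simp
  fix e :: real assume "0 < e"
  then have "0 < e / 2" by simp
  obtain \<phi> where \<phi>: "\<phi> \<in> \<Phi>" "\<And>x. x \<in> X\<^sub>c \<Longrightarrow> \<bar>\<psi> x - lift_data \<phi> x\<bar> \<le> e / 2"
    using \<Phi>'_approx[OF \<psi> \<open>0 < e / 2\<close>] by blast
  obtain g\<^sub>0 where g\<^sub>0: "g\<^sub>0 \<in> G" "\<And>x. x \<in> X\<^sub>c \<Longrightarrow> mdist X' (g x) (lift_aut g\<^sub>0 x) \<le> e / 2"
    using G'_approx[OF g \<open>0 < e / 2\<close>] by blast
  have "\<bar>compose X\<^sub>c \<psi> g x - lift_data (compose X \<phi> g\<^sub>0) x\<bar> \<le> e" if x: "x \<in> X\<^sub>c" for x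
  proof -
    have "\<bar>lift_data \<phi> (g x) - lift_data \<phi> (lift_aut g\<^sub>0 x)\<bar> \<le> e / 2"
      using nonexpansive_mdist[OF nonexpansive_lift_data[OF \<phi>(1)] G'_in[OF g x] lift_aut_in[OF g\<^sub>0(1) x]]
        g\<^sub>0(2)[OF x]
      by (simp add: dist_real_def)
    moreover have "\<bar>\<psi> (g x) - lift_data \<phi> (g x)\<bar> \<le> e / 2" using \<phi>(2) G'_in[OF g x] .
    ultimately show ?thesis
      unfolding lift_data_compose[OF \<phi>(1) g\<^sub>0(1)] compose_eq[OF x] by linarith
  qed
  then show "\<exists>\<phi>\<in>\<Phi>. \<forall>x\<in>X\<^sub>c. \<bar>compose X\<^sub>c \<psi> g x - lift_data \<phi> x\<bar> \<le> e"
    using G_act[OF \<phi>(1) g\<^sub>0(1)] by blast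
qed

lemma G'_one: "(\<lambda>x\<in>X\<^sub>c. x) \<in> G'"
  using lift_aut_in_G'[OF G_one] lift_aut_one by simp

lemma G'_mult:
  assumes g: "g \<in> G'" and h: "h \<in> G'"
  shows "compose X\<^sub>c g h \<in> G'"
  unfolding in_G'_iff
proof (intro conjI allI impI)
  show "compose X\<^sub>c g h \<in> X\<^sub>c \<rightarrow>\<^sub>E X\<^sub>c"
    using G'_in[OF g] G'_in[OF h] by (simp add: PiE_def compose_eq)
  fix e :: real assume "0 < e"
  then have "0 < e / 2" by simp
  obtain g\<^sub>0 where g\<^sub>0: "g\<^sub>0 \<in> G" "\<And>x. x \<in> X\<^sub>c \<Longrightarrow> mdist X' (g x) (lift_aut g\<^sub>0 x) \<le> e / 2"
    using G'_approx[OF g \<open>0 < e / 2\<close>] by blast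
  obtain h\<^sub>0 where h\<^sub>0: "h\<^sub>0 \<in> G" "\<And>x. x \<in> X\<^sub>c \<Longrightarrow> mdist X' (h x) (lift_aut h\<^sub>0 x) \<le> e / 2"
    using G'_approx[OF h \<open>0 < e / 2\<close>] by blast
  have "mdist X' (compose X\<^sub>c g h x) (lift_aut (compose X g\<^sub>0 h\<^sub>0) x) \<le> e" if x: "x \<in> X\<^sub>c" for x
  proof -
    have hx: "h x \<in> X\<^sub>c" "lift_aut h\<^sub>0 x \<in> X\<^sub>c" using G'_in[OF h x] lift_aut_in[OF h\<^sub>0(1) x] by auto
    have "mdist X' (lift_aut g\<^sub>0 (h x)) (lift_aut g\<^sub>0 (lift_aut h\<^sub>0 x)) \<le> e / 2"
      using mdist_lift_aut[OF g\<^sub>0(1) hx] h\<^sub>0(2)[OF x] by simp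
    then show ?thesis
      unfolding lift_aut_compose[OF g\<^sub>0(1) h\<^sub>0(1)] compose_eq[OF x]
      using M'.triangle[OF G'_in[OF g hx(1)] lift_aut_in[OF g\<^sub>0(1) hx(1)] lift_aut_in[OF g\<^sub>0(1) hx(2)]]
        g\<^sub>0(2)[OF hx(1)] by linarith
  qed
  then show "\<exists>g\<^sub>0\<in>G. \<forall>x\<in>X\<^sub>c. mdist X' (compose X\<^sub>c g h x) (lift_aut g\<^sub>0 x) \<le> e"
    using G_mult[OF g\<^sub>0(1) h\<^sub>0(1)] by blast
qed

lemma compact_X': "compact_space (mtopology_of X')"
  using M'.compact_space_eq_mcomplete_mtotally_bounded complete totally_bounded_X'
  by (simp add: mtopology_of_def mcomplete_of_def)

text \<open>
  If \<open>g\<close> is close to the extension of \<open>g\<^sub>0 \<in> G\<close>, then it maps the preimage of \<open>y\<close> under that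
  extension close to \<open>y\<close>. So the image of \<open>g\<close> is dense, and it is closed because \<open>X'\<close> is compact.
\<close>

lemma G'_surj:
  assumes g: "g \<in> G'"
  shows "g ` X\<^sub>c = X\<^sub>c"
proof
  show "g ` X\<^sub>c \<subseteq> X\<^sub>c" using G'_in[OF g] by blast
  have "continuous_map (mtopology_of X') (mtopology_of X') g"
    by (intro Cauchy_continuous_imp_continuous_map nonexpansive_imp_Cauchy_continuous_map nonexpansive_G' g)
  then have "compactin (mtopology_of X') (g ` X\<^sub>c)"
    using image_compactin[of "mtopology_of X'" "X\<^sub>c"] compact_X' by (simp add: compact_space_def)
  then have "closedin (mtopology_of X') (g ` X\<^sub>c)"
    using compactin_imp_closedin M'.Hausdorff_space_mtopology by (simp add: mtopology_of_def)
  then have closed: "Abstract_Topology.closure_of (mtopology_of X') (g ` X\<^sub>c) = g ` X\<^sub>c"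
    by (rule closure_of_closedin)
  show "X\<^sub>c \<subseteq> g ` X\<^sub>c"
  proof
    fix y assume y: "y \<in> X\<^sub>c"
    have "\<exists>z\<in>g ` X\<^sub>c. z \<in> X\<^sub>c \<and> mdist X' y z \<le> e" if e: "0 < e" for e
    proof -
      obtain g\<^sub>0 where g\<^sub>0: "g\<^sub>0 \<in> G" "\<And>x. x \<in> X\<^sub>c \<Longrightarrow> mdist X' (g x) (lift_aut g\<^sub>0 x) \<le> e"
        using G'_approx[OF g e] by blast
      obtain h where h: "h \<in> G" "\<And>x. x \<in> X\<^sub>c \<Longrightarrow> lift_aut g\<^sub>0 (lift_aut h x) = x"
        "\<And>x. x \<in> X\<^sub>c \<Longrightarrow> lift_aut h (lift_aut g\<^sub>0 x) = x"
        using lift_aut_inverse[OF g\<^sub>0(1)] by blast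
      have "lift_aut h y \<in> X\<^sub>c" using lift_aut_in[OF h(1) y] .
      then show ?thesis
        using g\<^sub>0(2)[of "lift_aut h y"] h(2)[OF y] G'_in[OF g] M'.commute[of y "g (lift_aut h y)"]
        by (intro bexI[of _ "g (lift_aut h y)"]) auto
    qed
    then have "y \<in> Abstract_Topology.closure_of (mtopology_of X') (g ` X\<^sub>c)"
      unfolding in_closure_of_iff_mdist_le using y by blast
    then show "y \<in> g ` X\<^sub>c" by (simp only: closed)
  qed
qed

lemma mdist_G':
  assumes g: "g \<in> G'" and x: "x \<in> X\<^sub>c" and y: "y \<in> X\<^sub>c"
  shows "mdist X' (g x) (g y) = mdist X' x y"
proof (rule antisym)
  show "mdist X' (g x) (g y) \<le> mdist X' x y" using nonexpansive_mdist[OF nonexpansive_G'[OF g] x y] .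
  show "mdist X' x y \<le> mdist X' (g x) (g y)"
  proof (rule field_le_epsilon)
    fix e :: real assume "0 < e"
    then have "0 < e / 2" by simp
    obtain g\<^sub>0 where g\<^sub>0: "g\<^sub>0 \<in> G" "\<And>x. x \<in> X\<^sub>c \<Longrightarrow> mdist X' (g x) (lift_aut g\<^sub>0 x) \<le> e / 2"
      using G'_approx[OF g \<open>0 < e / 2\<close>] by blast
    note gx = G'_in[OF g x] and gy = G'_in[OF g y]
      and lx = lift_aut_in[OF g\<^sub>0(1) x] and ly = lift_aut_in[OF g\<^sub>0(1) y]
    show "mdist X' x y \<le> mdist X' (g x) (g y) + e"
      using mdist_lift_aut[OF g\<^sub>0(1) x y] g\<^sub>0(2)[OF x] g\<^sub>0(2)[OF y]
        M'.triangle[OF lx gx ly] M'.triangle[OF gx gy ly] M'.commute[of "g x" "lift_aut g\<^sub>0 x"]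
      by linarith
  qed
qed

text \<open>
  As \<open>g\<close> is an isometry, \<open>g\<inverse>\<close> is as close to the extension of \<open>g\<^sub>0\<inverse>\<close> as \<open>g\<close> is to that of \<open>g\<^sub>0\<close>.
\<close>

lemma G'_inv:
  assumes g: "g \<in> G'"
  shows "\<exists>h\<in>G'. compose X\<^sub>c g h = (\<lambda>x\<in>X\<^sub>c. x) \<and> compose X\<^sub>c h g = (\<lambda>x\<in>X\<^sub>c. x)"
proof -
  have inj: "inj_on g X\<^sub>c"
    by (rule inj_onI) (metis M'.zero G'_in[OF g] mdist_G'[OF g])
  define h where "h = (\<lambda>x\<in>X\<^sub>c. inv_into X\<^sub>c g x)"
  have h_in: "h x \<in> X\<^sub>c" and gh: "g (h x) = x" if "x \<in> X\<^sub>c" for x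
    using that G'_surj[OF g] by (simp_all add: h_def inv_into_into f_inv_into_f)
  have hg: "h (g x) = x" if "x \<in> X\<^sub>c" for x
    using that G'_in[OF g] inj by (simp add: h_def)
  have "h \<in> G'"
    unfolding in_G'_iff
  proof (intro conjI allI impI)
    show "h \<in> X\<^sub>c \<rightarrow>\<^sub>E X\<^sub>c" using h_in by (auto simp: h_def)
    fix e :: real assume "0 < e"
    obtain g\<^sub>0 where g\<^sub>0: "g\<^sub>0 \<in> G" "\<And>x. x \<in> X\<^sub>c \<Longrightarrow> mdist X' (g x) (lift_aut g\<^sub>0 x) \<le> e"
      using G'_approx[OF g \<open>0 < e\<close>] by blast
    obtain h\<^sub>0 where h\<^sub>0: "h\<^sub>0 \<in> G" "\<And>x. x \<in> X\<^sub>c \<Longrightarrow> lift_aut g\<^sub>0 (lift_aut h\<^sub>0 x) = x"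
      "\<And>x. x \<in> X\<^sub>c \<Longrightarrow> lift_aut h\<^sub>0 (lift_aut g\<^sub>0 x) = x"
      using lift_aut_inverse[OF g\<^sub>0(1)] by blast
    have "mdist X' (h x) (lift_aut h\<^sub>0 x) \<le> e" if x: "x \<in> X\<^sub>c" for x
    proof -
      have l: "lift_aut h\<^sub>0 x \<in> X\<^sub>c" using lift_aut_in[OF h\<^sub>0(1) x] .
      have "mdist X' (h x) (lift_aut h\<^sub>0 x) = mdist X' x (g (lift_aut h\<^sub>0 x))"
        using mdist_G'[OF g h_in[OF x] l] gh[OF x] by simp
      then show ?thesis
        using g\<^sub>0(2)[OF l] h\<^sub>0(2)[OF x] M'.commute[of x] by simp
    qed
    then show "\<exists>g\<^sub>0\<in>G. \<forall>x\<in>X\<^sub>c. mdist X' (h x) (lift_aut g\<^sub>0 x) \<le> e" using h\<^sub>0(1) by blast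
  qed
  then show ?thesis
    using gh hg by (intro bexI[of _ h]) (auto simp: compose_def restrict_def)
qed

subsection \<open>Compactness and embedding\<close>

lemma perception_pair': "perception_pair X\<^sub>c \<Phi>' G'"
  unfolding perception_pair_iff
  using data_set_\<Phi>' G'_fun G'_one G'_mult G'_inv G'_act by (simp add: subset_iff)

lemma G'_in_funspace: "G' \<subseteq> mspace self_maps"
  unfolding in_funspace_X'_iff subset_iff using G'_fun by simp

lemma aut_dist'_le_iff:
  assumes "g \<in> G'" "h \<in> G'" "0 \<le> c"
  shows "aut_dist X\<^sub>c \<Phi>' g h \<le> ennreal c \<longleftrightarrow> (\<forall>x\<in>X\<^sub>c. mdist X' (g x) (h x) \<le> c)"
  using aut_dist_le_iff[OF perception_pair' assms] assms point_dist_\<Phi>' G'_in by simp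

lemma aut_dist':
  assumes "g \<in> G'" "h \<in> G'"
  shows "aut_dist X\<^sub>c \<Phi>' g h = ennreal (mdist self_maps g h)"
proof (rule ennreal_eq_by_real_bounds)
  fix c :: real assume "0 \<le> c"
  have "mdist self_maps g h \<le> c \<longleftrightarrow> (\<forall>x\<in>X\<^sub>c. mdist X' (g x) (h x) \<le> c)"
    using assms G'_in_funspace X'_nonempty by (intro funspace_mdist_le) auto
  then show "aut_dist X\<^sub>c \<Phi>' g h \<le> ennreal c \<longleftrightarrow> ennreal (mdist self_maps g h) \<le> ennreal c"
    unfolding aut_dist'_le_iff[OF assms \<open>0 \<le> c\<close>] ennreal_le_iff[OF \<open>0 \<le> c\<close>] by simp
qed

lemma topology_X': "epm_topology X\<^sub>c (point_dist \<Phi>') = mtopology_of X'"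
  using epm_topology_eq_subtopology[of "X\<^sub>c" X' "point_dist \<Phi>'"] point_dist_\<Phi>'
    subtopology_topspace[of "mtopology_of X'"] by simp

lemma topology_\<Phi>': "mtopology_of (data_metric X\<^sub>c \<Phi>') = subtopology (mtopology_of real_functions) \<Phi>'"
  by (simp add: data_metric_def mtopology_of_submetric del: mspace_funspace mdist_funspace)

lemma topology_G': "epm_topology G' (aut_dist X\<^sub>c \<Phi>') = subtopology (mtopology_of self_maps) G'"
  by (intro epm_topology_eq_subtopology G'_in_funspace aut_dist')

lemma compact_\<Phi>': "compact_space (subtopology (mtopology_of real_functions) \<Phi>')"
  unfolding \<Phi>'_def
proof (rule compact_space_closure_of_totally_bounded)
  show "mcomplete_of real_functions"
    using Met_TC.mcomplete_funspace[of "X\<^sub>c"] complete_real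
    by (simp add: Met_TC.Self_def euclidean_metric_def)
  have "nonexpansive (data_metric X \<Phi>) real_functions lift_data"
    unfolding nonexpansive_def
  proof (intro conjI ballI)
    have space: "mspace (data_metric X \<Phi>) = \<Phi>"
      using data_set_X unfolding data_metric_def data_set_def mspace_submetric by blast
    show "lift_data \<in> mspace (data_metric X \<Phi>) \<rightarrow> mspace real_functions"
      unfolding space using lift_data_in_funspace by blast
    fix \<phi> \<psi> assume "\<phi> \<in> mspace (data_metric X \<Phi>)" "\<psi> \<in> mspace (data_metric X \<Phi>)"
    then have mem: "\<phi> \<in> \<Phi>" "\<psi> \<in> \<Phi>" by (simp_all only: space)
    have "\<forall>x\<in>X\<^sub>c. mdist euclidean_metric (lift_data \<phi> x) (lift_data \<psi> x) \<le> mdist (data_metric X \<Phi>) \<phi> \<psi>"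
      using lift_data_near_iff[OF mem] by (simp add: dist_real_def)
    then show "mdist real_functions (lift_data \<phi>) (lift_data \<psi>) \<le> mdist (data_metric X \<Phi>) \<phi> \<psi>"
      using mem lift_data_in_funspace X'_nonempty
      by (intro funspace_mdist_le[THEN iffD2]) blast+
  qed
  then show "Metric_space.mtotally_bounded (mspace real_functions) (mdist real_functions) (lift_data ` \<Phi>)"
    by (intro mtotally_bounded_Cauchy_continuous_image[OF nonexpansive_imp_Cauchy_continuous_map tb_data])
qed

lemma compact_G': "compact_space (subtopology (mtopology_of self_maps) G')"
  unfolding G'_def
proof (rule compact_space_closure_of_totally_bounded)
  show "mcomplete_of self_maps"
    using M'.mcomplete_funspace[of "X\<^sub>c"] complete M'.Self_def
    by (simp add: mcomplete_of_def del: mspace_funspace mdist_funspace)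
  show "Metric_space.mtotally_bounded (mspace self_maps) (mdist self_maps) (lift_aut ` G)"
    using totally_bounded_X' lift_aut_in_funspace nonexpansive_lift_aut X'_nonempty
    by (intro totally_bounded_nonexpansive_maps) auto
qed

lemma compact_pair: "compact_perception_pair X\<^sub>c \<Phi>' G'"
  unfolding compact_perception_pair_def topology_\<Phi>' topology_G' topology_X'
  using perception_pair' compact_\<Phi>' compact_G' compact_X' by blast

lemma isometric_embedding_j: "isometric_embedding X (point_dist \<Phi>) X\<^sub>c (point_dist \<Phi>') j"
  using j_in mdist_j inj_on_j
  by (auto simp: isometric_embedding_def point_dist_\<Phi>' point_dist_eq_mdist[OF metric_points])

lemma isometric_embedding_lift_data:
  "isometric_embedding \<Phi> (mdist (data_metric X \<Phi>)) \<Phi>' (mdist (data_metric X\<^sub>c \<Phi>')) lift_data"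
  unfolding isometric_embedding_def
proof (intro conjI ballI inj_onI)
  show "lift_data \<in> \<Phi> \<rightarrow> \<Phi>'" using lift_data_in by blast
  fix \<phi> \<psi> assume mem: "\<phi> \<in> \<Phi>" "\<psi> \<in> \<Phi>"
  show "mdist (data_metric X\<^sub>c \<Phi>') (lift_data \<phi>) (lift_data \<psi>) = mdist (data_metric X \<Phi>) \<phi> \<psi>"
    using lift_data_near_iff[OF mem]
      mdist_data_metric_le_iff[OF data_set_\<Phi>' lift_data_in[OF mem(1)] lift_data_in[OF mem(2)]]
    by (metis order_antisym order_refl)
  assume eq: "lift_data \<phi> = lift_data \<psi>"
  have "\<phi> \<in> extensional X" "\<psi> \<in> extensional X"
    using mem data_set_X unfolding data_set_def mspace_bounded_functions by blast+
  then show "\<phi> = \<psi>"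
    by (rule extensionalityI) (metis eq lift_data_j mem)
qed

lemma isometric_embedding_lift_aut:
  "isometric_embedding G (aut_dist X \<Phi>) G' (aut_dist X\<^sub>c \<Phi>') lift_aut"
  unfolding isometric_embedding_def
proof (intro conjI ballI inj_onI)
  show "lift_aut \<in> G \<rightarrow> G'" using lift_aut_in_G' by blast
  fix g h assume mem: "g \<in> G" "h \<in> G"
  show "aut_dist X\<^sub>c \<Phi>' (lift_aut g) (lift_aut h) = aut_dist X \<Phi> g h"
  proof (rule ennreal_eq_by_real_bounds)
    fix c :: real assume c: "0 \<le> c"
    have at_j: "mdist X' (lift_aut g (j x)) (lift_aut h (j x)) = mdist P (g x) (h x)" if "x \<in> X" for x
      using that mem by (simp add: lift_aut_j mdist_j G_in)
    have "(\<forall>x\<in>X\<^sub>c. mdist X' (lift_aut g x) (lift_aut h x) \<le> c) \<longleftrightarrow> (\<forall>x\<in>X. mdist P (g x) (h x) \<le> c)"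
    proof
      show "\<forall>x\<in>X. mdist P (g x) (h x) \<le> c" if "\<forall>x\<in>X\<^sub>c. mdist X' (lift_aut g x) (lift_aut h x) \<le> c"
        using that at_j j_in by fastforce
      show "\<forall>x\<in>X\<^sub>c. mdist X' (lift_aut g x) (lift_aut h x) \<le> c" if "\<forall>x\<in>X. mdist P (g x) (h x) \<le> c"
        using mdist_le_by_density[OF nonexpansive_lift_aut[OF mem(1)] nonexpansive_lift_aut[OF mem(2)], of c]
          that at_j by simp
    qed
    then show "aut_dist X\<^sub>c \<Phi>' (lift_aut g) (lift_aut h) \<le> ennreal c \<longleftrightarrow> aut_dist X \<Phi> g h \<le> ennreal c"
      using aut_dist'_le_iff[OF lift_aut_in_G'[OF mem(1)] lift_aut_in_G'[OF mem(2)] c]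
        aut_dist_le_iff[OF pair mem c] c mem
      by (simp add: point_dist_eq_mdist[OF metric_points] G_in)
  qed
  assume eq: "lift_aut g = lift_aut h"
  have "j (g x) = j (h x)" if "x \<in> X" for x
    using lift_aut_j[OF mem(1) that] lift_aut_j[OF mem(2) that] eq by simp
  then have "g x = h x" if "x \<in> X" for x
    using that inj_on_j G_in mem unfolding inj_on_def by simp
  then show "g = h"
    using PiE_ext[OF G_fun[OF mem(1)] G_fun[OF mem(2)]] by blast
qed

lemma compactification': "compactification X \<Phi> G X\<^sub>c \<Phi>' G'"
  unfolding compactification_def isometrically_embedded_def
proof (intro conjI compact_pair exI[of _ j] exI[of _ lift_data] exI[of _ lift_aut] ballI
    isometric_embedding_j isometric_embedding_lift_data isometric_embedding_lift_aut)
  show "dense_in (epm_topology X\<^sub>c (point_dist \<Phi>')) (j ` X)"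
    unfolding topology_X' dense_in_def using closure_j j_in by auto
  show "dense_in (mtopology_of (data_metric X\<^sub>c \<Phi>')) (lift_data ` \<Phi>)"
    unfolding topology_\<Phi>' unfolding \<Phi>'_def
    by (rule dense_in_closure) (use lift_data_in_funspace in \<open>simp only: topspace_mtopology_of\<close>)
  show "dense_in (epm_topology G' (aut_dist X\<^sub>c \<Phi>')) (lift_aut ` G)"
    unfolding topology_G' unfolding G'_def
    by (rule dense_in_closure) (use lift_aut_in_funspace in \<open>simp only: topspace_mtopology_of\<close>)
  show "compose X (lift_data \<phi>) j = \<phi>" if "\<phi> \<in> \<Phi>" for \<phi>
  proof (rule extensionalityI)
    show "\<phi> \<in> extensional X"
      using that data_set_X unfolding data_set_def mspace_bounded_functions by blast
  qed (simp_all add: compose_eq lift_data_j that)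
  show "compose X (lift_aut g) j = compose X j g" if "g \<in> G" for g
    by (rule extensionalityI[of _ X]) (simp_all add: compose_eq lift_aut_j that)
qed

end


section \<open>Existence of a compactification\<close>

theorem theorem32:
  fixes X :: "'a set" and \<Phi> :: "('a \<Rightarrow> real) set" and G :: "('a \<Rightarrow> 'a) set"
  assumes "perception_pair X \<Phi> G"
    and "Metric_space.mtotally_bounded (mspace (data_metric X \<Phi>)) (mdist (data_metric X \<Phi>)) \<Phi>"
    and "is_metric X (point_dist \<Phi>)"
  shows "\<exists>(X' :: ('a \<Rightarrow> real) set) \<Phi>' G'. compactification X \<Phi> G X' \<Phi>' G'"
proof -
  let ?P = "point_metric X \<Phi>"
  interpret P: Metric_space "mspace ?P" "mdist ?P" by (rule Metric_space_mspace_mdist)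
  show ?thesis
  proof (rule P.metric_completion)
    fix j :: "'a \<Rightarrow> 'a \<Rightarrow> real" and X'
    assume "mcomplete_of X'" "j \<in> mspace ?P \<rightarrow> mspace X'"
      "Abstract_Topology.closure_of (mtopology_of X') (j ` mspace ?P) = mspace X'"
      "\<And>x y. x \<in> mspace ?P \<Longrightarrow> y \<in> mspace ?P \<Longrightarrow> mdist X' (j x) (j y) = mdist ?P x y"
    then interpret completed_pair X \<Phi> X' j G
      using assms by unfold_locales blast+
    show ?thesis using compactification' by blast
  qed
qed

end
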